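(* Let $(a_1,\dots,a_n,\dots)$ be an infinite sequence in $\mathbf{D}$, where each $a_n$ in the sequence is allowed to repeat, with associated generalized reproducing kernels $\tilde k_{a_1},\tilde k_{a_2},\dots$. Let the Gram–Schmidt orthonormalization of $(\tilde k_{a_1},\dots,\tilde k_{a_n})$ in $\mathbb{A}^2(\mathbf{D})$ be denoted $(B_1,\dots,B_n)$, and put $A_n=(a_1,\dots,a_n)$. Then for any $n$: (i) The reproducing kernel of the zero-based invariant subspace $I_{A_n}$ is $$K_{A_n}(z,w)=\sqrt{\|k_w\|^2-\sum_{k=1}^n|\langle k_w,B_k\rangle|^2}\;B_{n+1}^w(z),\qquad K_{A_0}(z,w)=K(z,w),$$ where $(B_1,\dots,B_n,B_{n+1}^w)$ is the Gram–Schmidt orthonormalization of $(\tilde k_{a_1},\dots,\tilde k_{a_n},k_w)$ and $w$ is none of $a_1,\dots,a_n$. (ii) If $a_{n+1}$ coincides with some $a_k$, $k=1,\dots,n$, that is, $l(a_{n+1})>1$, then $B_{n+1}^{a_{n+1}}$ is defined through $$\lim_{w\to a_{n+1}}B_{n+1}^w=\frac{\tilde k_{a_{n+1}}(z)-\sum_{k=1}^n\langle\tilde k_{a_{n+1}},B_k\rangle B_k(z)}{\big\|\tilde k_{a_{n+1}}-\sum_{k=1}^n\langle\tilde k_{a_{n+1}},B_k\rangle B_k\big\|}=\frac{\tilde k_{a_{n+1}}(z)-\sum_{k=1}^n\langle\tilde k_{a_{n+1}},B_k\rangle B_k(z)}{\sqrt{\|\tilde k_{a_{n+1}}\|^2-\sum_{k=1}^n|\langle\tilde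 k_{a_{n+1}},B_k\rangle|^2}},$$ and thus $B_{n+1}:=B_{n+1}^{a_{n+1}}$.
   Context: $\mathbf{D}$ is the open unit disc. $\mathbb{A}^2(\mathbf{D})$ is the Hilbert space of holomorphic functions $f$ on $\mathbf{D}$ with $\|f\|^2=\int_{\mathbf{D}}|f|^2\,dA<\infty$, where $dA=dx\,dy/\pi$, with inner product $\langle f,g\rangle=\int_{\mathbf{D}}f\overline g\,dA$. Its reproducing kernel is $K(z,w)=k_w(z)=\frac{1}{(1-\overline w z)^2}$. For a sequence of points of $\mathbf{D}$ (repetitions allowed), $l(a_n)$ is the number of times the value $a_n$ occurs in $(a_1,\dots,a_n)$, and the generalized reproducing kernel is $\tilde k_{a_n}(z)=\left(\frac{d}{d\overline w}\right)^{l(a_n)-1}k_w(z)\big|_{w=a_n}$. For an ordered tuple $A$ of points of $\mathbf{D}$, the zero-based invariant subspace $I_A$ is the closed subspace of all $f\in\mathbb{A}^2(\mathbf{D})$ vanishing at the points of $A$ counted with multiplicity: if $a$ occurs $l$ times in $A$, then $f(a)=f'(a)=\dots=f^{(l-1)}(a)=0$; for the empty tuple $A_0$, $I_{A_0}=\mathbb{A}^2(\mathbf{D})$. The Gram–Schmidt orthonormalization subtracts from each vector its projection on the span of the preceding ones and divides by the norm.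
   Formalization: In (ii) the limit of B_{n+1}^w does not exist (a_1=a_2=0: it behaves like (w̄/|w|)√2 z); proved instead, with b=a_{n+1}, m=l(b)-1: the limit of ((w-b)/|w-b|)^m B_{n+1}^w, and the limit of B_{n+1}^w along directions where ((w-b)/|w-b|)^m=1. *)

theory Defs
  imports "HOL-Complex_Analysis.Complex_Analysis"
begin

text \<open>
  Functions on the open unit disc are represented by functions of type
  \<^typ>\<open>complex \<Rightarrow> complex\<close>; only their values on the disc are relevant, and equality of two such
  functions is always stated pointwise on the disc.
  Sequences of points, vectors, and orthonormal bases are indexed from 1; the entry at index 0
  is never used.
\<close>

abbreviation unit_disc :: "complex set" where
  "unit_disc \<equiv> ball 0 1"

definition bergman_space :: "(complex \<Rightarrow> complex) set" where
  "bergman_space = {f. f holomorphic_on unit_disc \<and>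
     set_integrable lborel unit_disc (\<lambda>z. (cmod (f z))\<^sup>2)}"

definition bergman_inner :: "(complex \<Rightarrow> complex) \<Rightarrow> (complex \<Rightarrow> complex) \<Rightarrow> complex" where
  "bergman_inner f g = (LINT z:unit_disc|lborel. f z * cnj (g z)) / of_real pi"

definition bergman_norm :: "(complex \<Rightarrow> complex) \<Rightarrow> real" where
  "bergman_norm f = sqrt ((LINT z:unit_disc|lborel. (cmod (f z))\<^sup>2) / pi)"

text \<open>
  Convergence in the Bergman space. The membership conditions are needed because
  \<^const>\<open>bergman_norm\<close> takes the value 0 at functions that are not square integrable.
\<close>

definition bergman_tendsto ::
    "('b \<Rightarrow> complex \<Rightarrow> complex) \<Rightarrow> (complex \<Rightarrow> complex) \<Rightarrow> 'b filter \<Rightarrow> bool" where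
  "bergman_tendsto f g F \<longleftrightarrow>
     g \<in> bergman_space \<and> (\<forall>\<^sub>F w in F. f w \<in> bergman_space) \<and>
     ((\<lambda>w. bergman_norm (\<lambda>z. f w z - g z)) \<longlongrightarrow> 0) F"

definition bergman_kernel :: "complex \<Rightarrow> complex \<Rightarrow> complex" where
  "bergman_kernel z w = 1 / (1 - cnj w * z)\<^sup>2"

abbreviation kernel_at :: "complex \<Rightarrow> complex \<Rightarrow> complex" where
  "kernel_at w \<equiv> (\<lambda>z. bergman_kernel z w)"

definition reproducing_kernel ::
    "(complex \<Rightarrow> complex) set \<Rightarrow> (complex \<Rightarrow> complex \<Rightarrow> complex) \<Rightarrow> bool" where
  "reproducing_kernel H K \<longleftrightarrow>
     (\<forall>w\<in>unit_disc. (\<lambda>z. K z w) \<in> H \<and> (\<forall>f\<in>H. f w = bergman_inner f (\<lambda>z. K z w)))"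

text \<open>The Wirtinger derivative with respect to the conjugate variable, (d/dx + i d/dy) / 2.\<close>

definition wirtinger_bar :: "(complex \<Rightarrow> complex) \<Rightarrow> complex \<Rightarrow> complex" where
  "wirtinger_bar g w =
     (frechet_derivative g (at w) 1 + \<i> * frechet_derivative g (at w) \<i>) / 2"

definition initial_tuple :: "(nat \<Rightarrow> complex) \<Rightarrow> nat \<Rightarrow> complex list" where
  "initial_tuple a n = map a [1..<Suc n]"

definition occurrence :: "(nat \<Rightarrow> complex) \<Rightarrow> nat \<Rightarrow> nat" where
  "occurrence a n = count_list (initial_tuple a n) (a n)"

definition gen_kernel :: "(nat \<Rightarrow> complex) \<Rightarrow> nat \<Rightarrow> complex \<Rightarrow> complex" where
  "gen_kernel a n z = (wirtinger_bar ^^ (occurrence a n - 1)) (\<lambda>w. bergman_kernel z w) (a n)"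

definition zero_based_subspace :: "complex list \<Rightarrow> (complex \<Rightarrow> complex) set" where
  "zero_based_subspace A =
     {f \<in> bergman_space. \<forall>c\<in>set A. \<forall>j<count_list A c. (deriv ^^ j) f c = 0}"

text \<open>
  Orthogonal projection of \<open>f\<close> on the complex span of \<open>v 1, \<dots>, v (n - 1)\<close>. For vectors in the
  Bergman space it exists, and its values on the disc are unique.
\<close>

definition proj_preceding ::
    "(nat \<Rightarrow> complex \<Rightarrow> complex) \<Rightarrow> nat \<Rightarrow> (complex \<Rightarrow> complex) \<Rightarrow> complex \<Rightarrow> complex" where
  "proj_preceding v n f =
     (SOME p. (\<exists>c. p = (\<lambda>z. \<Sum>j\<in>{1..<n}. c j * v j z)) \<and>
              (\<forall>j\<in>{1..<n}. bergman_inner (\<lambda>z. f z - p z) (v j) = 0))"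

definition gram_schmidt_vec ::
    "(nat \<Rightarrow> complex \<Rightarrow> complex) \<Rightarrow> nat \<Rightarrow> complex \<Rightarrow> complex" where
  "gram_schmidt_vec v n z =
     (v n z - proj_preceding v n (v n) z) /
     of_real (bergman_norm (\<lambda>z. v n z - proj_preceding v n (v n) z))"

definition basis_vec :: "(nat \<Rightarrow> complex) \<Rightarrow> nat \<Rightarrow> complex \<Rightarrow> complex" where
  "basis_vec a n = gram_schmidt_vec (gen_kernel a) n"

text \<open>
  \<open>ext_basis_vec a n w\<close> is the last vector obtained by orthonormalizing the generalized kernels
  for \<open>a 1, \<dots>, a n\<close> followed by the kernel at \<open>w\<close>.
\<close>

definition ext_basis_vec :: "(nat \<Rightarrow> complex) \<Rightarrow> nat \<Rightarrow> complex \<Rightarrow> complex \<Rightarrow> complex" where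
  "ext_basis_vec a n w = gram_schmidt_vec ((gen_kernel a)(Suc n := kernel_at w)) (Suc n)"

definition kernel_residual :: "(nat \<Rightarrow> complex) \<Rightarrow> nat \<Rightarrow> complex \<Rightarrow> complex" where
  "kernel_residual a n z = gen_kernel a (Suc n) z -
     (\<Sum>k=1..n. bergman_inner (gen_kernel a (Suc n)) (basis_vec a k) * basis_vec a k z)"

text \<open>
  The vectors \<open>ext_basis_vec a n w\<close> are normalized by a positive factor. If \<open>b = a (Suc n)\<close> occurs
  \<open>m > 0\<close> times among \<open>a 1, \<dots>, a n\<close>, then, as \<open>w\<close> tends to \<open>b\<close>, they are asymptotic to
  \<open>cnj (sgn (w - b)) ^ m\<close> times a fixed unit vector, so they have no unrestricted limit: for
  \<open>a 1 = a 2 = 0\<close>, \<open>n = 1\<close> they are asymptotic to \<open>cnj (sgn w) * sqrt 2 * z\<close>.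
  The following factor removes this rotation; it equals 1 in particular when \<open>w - b > 0\<close>.
\<close>

definition approach_phase :: "(nat \<Rightarrow> complex) \<Rightarrow> nat \<Rightarrow> complex \<Rightarrow> complex" where
  "approach_phase a n w = sgn (w - a (Suc n)) ^ (occurrence a (Suc n) - 1)"

end

theory Submission
  imports Defs
begin

text \<open>
  If \<open>f = (\<Sum>j. c j * z ^ j)\<close>, then \<open>\<langle>f, z ^ j\<rangle> = c j / (j + 1)\<close>, because the monomials are orthogonal by
  rotation invariance of the area measure. Expanding the kernel in powers of \<open>z\<close> gives
  \<open>f w = \<langle>f, k w\<rangle>\<close>, and differentiating in \<open>w\<close> turns pairing with a generalized kernel into the
  evaluation of a derivative. Hence \<open>I_A\<close> is the orthogonal complement of finitely many generalized
  kernels, and its reproducing kernel at \<open>w\<close> is the Gram--Schmidt residual of \<open>k w\<close>. If \<open>b = a (Suc n)\<close>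
  occurs \<open>m\<close> times among \<open>a 1, \<dots>, a n\<close>, the Taylor terms of \<open>k w\<close> at \<open>b\<close> of order less than \<open>m\<close> lie in
  the span of the preceding kernels, so the residual of \<open>k w\<close> is \<open>cnj (w - b) ^ m / fact m\<close> times the
  residual of the new generalized kernel, up to \<open>O(cmod (w - b) ^ Suc m)\<close>. The latter residual is
  not zero because \<open>\<Prod>i = 1..n. z - a i\<close> vanishes at \<open>b\<close> to order exactly \<open>m\<close>.
\<close>

section \<open>The Hilbert space structure\<close>

text \<open>Functions count only through their values on the disc and \<open>proj_preceding\<close>
  is picked by \<open>SOME\<close>, so projections are compared pointwise on the disc. This
  comparison rests on definiteness of the norm, which itself comes from the reproducing property,
  because that property bounds point evaluations. Cauchy-Schwarz precedes definiteness and has to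
  treat vectors of norm 0 by hand. The obstacle in (ii) is that the residual of \<open>k w\<close>
  tends to 0 like \<open>cmod (w - b) ^ m\<close>, so dividing by its norm requires a relative error
  that tends to 0. One more power of \<open>cmod (w - b)\<close> in the Taylor remainder supplies
  it. The leading coefficient has a varying argument; \<open>approach_phase\<close> makes it
  positive, and positive factors cancel on normalization.\<close>

lemma bergman_space_holomorphic: "f \<in> bergman_space \<Longrightarrow> f holomorphic_on unit_disc"
  by (simp add: bergman_space_def)

lemma continuous_set_borel_measurable:
  fixes f :: "complex \<Rightarrow> 'b::real_normed_vector"
  shows "continuous_on unit_disc f \<Longrightarrow> set_borel_measurable lborel unit_disc f"
  unfolding set_borel_measurable_def
  by (simp add: borel_measurable_continuous_on_indicator)

lemma set_integrable_const_disc: "set_integrable lborel unit_disc (\<lambda>z::complex. c::real)"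
proof -
  have "integrable lborel (indicat_real (unit_disc :: complex set))"
    using emeasure_lborel_ball_finite[of "0::complex" 1] by (intro integrable_real_indicator) simp_all
  then show ?thesis by (simp add: set_integrable_def)
qed

lemma bergman_space_cong:
  assumes "f \<in> bergman_space" "\<And>z. z \<in> unit_disc \<Longrightarrow> f z = g z"
  shows "g \<in> bergman_space"
proof -
  have "g holomorphic_on unit_disc"
    using assms(1) assms(2) holomorphic_transform bergman_space_holomorphic by blast
  moreover have "set_integrable lborel unit_disc (\<lambda>z. (cmod (g z))\<^sup>2)
      = set_integrable lborel unit_disc (\<lambda>z. (cmod (f z))\<^sup>2)"
    by (rule set_integrable_cong) (use assms(2) in auto)
  ultimately show ?thesis using assms(1) by (simp add: bergman_space_def)
qed

lemma bergman_space_add: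
  assumes f: "f \<in> bergman_space" and g: "g \<in> bergman_space"
  shows "(\<lambda>z. f z + g z) \<in> bergman_space"
proof -
  have hol: "(\<lambda>z. f z + g z) holomorphic_on unit_disc"
    using f g by (intro holomorphic_intros) (auto simp: bergman_space_def)
  have "set_integrable lborel unit_disc (\<lambda>z. 2 * (cmod (f z))\<^sup>2 + 2 * (cmod (g z))\<^sup>2)"
    using f g by (intro set_integral_add set_integrable_mult_right) (auto simp: bergman_space_def)
  moreover have "set_borel_measurable lborel unit_disc (\<lambda>z. (cmod (f z + g z))\<^sup>2)"
    by (intro continuous_set_borel_measurable continuous_intros holomorphic_on_imp_continuous_on
        bergman_space_holomorphic f g)
  moreover have "(cmod (f z + g z))\<^sup>2 \<le> 2 * (cmod (f z))\<^sup>2 + 2 * (cmod (g z))\<^sup>2" for z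
  proof -
    have "(cmod (f z + g z))\<^sup>2 \<le> (cmod (f z) + cmod (g z))\<^sup>2"
      by (simp add: norm_triangle_ineq power_mono)
    also have "\<dots> \<le> 2 * (cmod (f z))\<^sup>2 + 2 * (cmod (g z))\<^sup>2"
      using sum_squares_bound[of "cmod (f z)" "cmod (g z)"] by (simp add: power2_sum)
    finally show ?thesis .
  qed
  ultimately have "set_integrable lborel unit_disc (\<lambda>z. (cmod (f z + g z))\<^sup>2)"
    by (auto intro: set_integrable_bound)
  with hol show ?thesis by (simp add: bergman_space_def)
qed

lemma bergman_space_scale:
  assumes "f \<in> bergman_space"
  shows "(\<lambda>z. c * f z) \<in> bergman_space"
  using assms by (auto simp: bergman_space_def norm_mult power_mult_distrib intro!: holomorphic_intros)

lemma bergman_space_zero: "(\<lambda>z. 0) \<in> bergman_space"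
  by (simp add: bergman_space_def set_integrable_def)

lemma bergman_space_sum:
  "(\<And>i. i \<in> I \<Longrightarrow> f i \<in> bergman_space) \<Longrightarrow> (\<lambda>z. \<Sum>i\<in>I. f i z) \<in> bergman_space"
  by (induction I rule: infinite_finite_induct) (auto simp: bergman_space_zero intro: bergman_space_add)

lemma bergman_space_diff:
  assumes "f \<in> bergman_space" "g \<in> bergman_space"
  shows "(\<lambda>z. f z - g z) \<in> bergman_space"
  using bergman_space_add[OF assms(1) bergman_space_scale[OF assms(2), of "-1"]] by simp

lemma bergman_space_divide:
  "f \<in> bergman_space \<Longrightarrow> (\<lambda>z. f z / c) \<in> bergman_space"
  using bergman_space_scale[of f "1 / c"] by simp

lemmas bergman_space_intros =
  bergman_space_add bergman_space_diff bergman_space_scale bergman_space_divide bergman_space_sum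

lemma bergman_integrable_mult:
  assumes f: "f \<in> bergman_space" and g: "g \<in> bergman_space"
  shows "set_integrable lborel unit_disc (\<lambda>z. f z * cnj (g z))"
proof -
  have "set_integrable lborel unit_disc (\<lambda>z. (cmod (f z))\<^sup>2 + (cmod (g z))\<^sup>2)"
    using f g by (intro set_integral_add) (auto simp: bergman_space_def)
  moreover have "set_borel_measurable lborel unit_disc (\<lambda>z. f z * cnj (g z))"
    by (intro continuous_set_borel_measurable continuous_intros holomorphic_on_imp_continuous_on
        bergman_space_holomorphic f g)
  moreover have "cmod (f z * cnj (g z)) \<le> (cmod (f z))\<^sup>2 + (cmod (g z))\<^sup>2" for z
  proof -
    have "2 * (cmod (f z) * cmod (g z)) \<le> (cmod (f z))\<^sup>2 + (cmod (g z))\<^sup>2"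
      using sum_squares_bound[of "cmod (f z)" "cmod (g z)"] by (simp add: mult.assoc)
    moreover have "0 \<le> cmod (f z) * cmod (g z)" by simp
    ultimately show ?thesis unfolding norm_mult complex_mod_cnj by linarith
  qed
  ultimately show ?thesis
    by (auto intro: set_integrable_bound)
qed

text \<open>Monomials, kernels, their derivatives and products of linear factors all enter the space
  through this criterion.\<close>

lemma bergman_space_bounded:
  assumes "f holomorphic_on unit_disc" "\<And>z. z \<in> unit_disc \<Longrightarrow> cmod (f z) \<le> B"
  shows "f \<in> bergman_space"
proof -
  have "set_integrable lborel unit_disc (\<lambda>z::complex. B\<^sup>2)"
    by (rule set_integrable_const_disc)
  moreover have "set_borel_measurable lborel unit_disc (\<lambda>z. (cmod (f z))\<^sup>2)"
    by (intro continuous_set_borel_measurable continuous_intros holomorphic_on_imp_continuous_on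
        assms)
  moreover have "norm ((cmod (f z))\<^sup>2) \<le> norm (B\<^sup>2)" if "z \<in> unit_disc" for z
    using assms(2)[OF that] by (simp add: power_mono)
  ultimately have "set_integrable lborel unit_disc (\<lambda>z. (cmod (f z))\<^sup>2)"
    by (auto intro: set_integrable_bound)
  with assms(1) show ?thesis by (simp add: bergman_space_def)
qed

section \<open>Sesquilinearity, Cauchy-Schwarz and the triangle inequality\<close>

lemma bergman_inner_cong:
  assumes "\<And>z. z \<in> unit_disc \<Longrightarrow> f z = f' z" "\<And>z. z \<in> unit_disc \<Longrightarrow> g z = g' z"
  shows "bergman_inner f g = bergman_inner f' g'"
  unfolding bergman_inner_def using assms
  by (subst set_lebesgue_integral_cong[of unit_disc lborel _ "\<lambda>z. f' z * cnj (g' z)"]) auto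

lemma bergman_norm_cong:
  assumes "\<And>z. z \<in> unit_disc \<Longrightarrow> f z = g z"
  shows "bergman_norm f = bergman_norm g"
  unfolding bergman_norm_def using assms
  by (subst set_lebesgue_integral_cong[of unit_disc lborel _ "\<lambda>z. (cmod (g z))\<^sup>2"]) auto

lemma bergman_inner_commute: "bergman_inner g f = cnj (bergman_inner f g)"
proof -
  have "cnj (LINT z:unit_disc|lborel. f z * cnj (g z)) = (LINT z:unit_disc|lborel. g z * cnj (f z))"
    unfolding set_lebesgue_integral_def
    by (subst Bochner_Integration.integral_cnj[symmetric])
       (simp add: mult.commute del: Bochner_Integration.integral_cnj)
  then show ?thesis by (simp add: bergman_inner_def)
qed

lemma bergman_inner_add_left:
  assumes "f \<in> bergman_space" "g \<in> bergman_space" "h \<in> bergman_space"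
  shows "bergman_inner (\<lambda>z. f z + g z) h = bergman_inner f h + bergman_inner g h"
  unfolding bergman_inner_def
  using set_integral_add(2)[OF bergman_integrable_mult[OF assms(1,3)] bergman_integrable_mult[OF assms(2,3)]]
  by (simp add: algebra_simps add_divide_distrib)

lemma bergman_inner_scale_left: "bergman_inner (\<lambda>z. c * f z) h = c * bergman_inner f h"
  unfolding bergman_inner_def by (simp add: mult.assoc)

lemma bergman_inner_divide_left: "bergman_inner (\<lambda>z. f z / c) h = bergman_inner f h / c"
  using bergman_inner_scale_left[of "1 / c" f h] by simp

lemma bergman_inner_zero_left: "bergman_inner (\<lambda>z. 0) h = 0"
  by (simp add: bergman_inner_def)

lemma bergman_inner_diff_left:
  assumes "f \<in> bergman_space" "g \<in> bergman_space" "h \<in> bergman_space"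
  shows "bergman_inner (\<lambda>z. f z - g z) h = bergman_inner f h - bergman_inner g h"
  using bergman_inner_add_left[OF assms(1) bergman_space_scale[OF assms(2), of "-1"] assms(3)]
    bergman_inner_scale_left[of "-1" g h] by simp

lemma bergman_inner_sum_left:
  assumes "\<And>i. i \<in> I \<Longrightarrow> f i \<in> bergman_space" "h \<in> bergman_space"
  shows "bergman_inner (\<lambda>z. \<Sum>i\<in>I. f i z) h = (\<Sum>i\<in>I. bergman_inner (f i) h)"
  using assms
  by (induction I rule: infinite_finite_induct)
     (simp_all add: bergman_inner_zero_left bergman_inner_add_left bergman_space_sum)

lemma bergman_inner_add_right:
  assumes "f \<in> bergman_space" "g \<in> bergman_space" "h \<in> bergman_space"
  shows "bergman_inner h (\<lambda>z. f z + g z) = bergman_inner h f + bergman_inner h g"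
  using bergman_inner_add_left[OF assms] by (metis bergman_inner_commute complex_cnj_add)

lemma bergman_inner_diff_right:
  assumes "f \<in> bergman_space" "g \<in> bergman_space" "h \<in> bergman_space"
  shows "bergman_inner h (\<lambda>z. f z - g z) = bergman_inner h f - bergman_inner h g"
  using bergman_inner_diff_left[OF assms] by (metis bergman_inner_commute complex_cnj_diff)

lemma bergman_inner_scale_right: "bergman_inner h (\<lambda>z. c * f z) = cnj c * bergman_inner h f"
  using bergman_inner_scale_left[of c f h] by (metis bergman_inner_commute complex_cnj_mult)

lemma bergman_inner_sum_right:
  assumes "\<And>i. i \<in> I \<Longrightarrow> f i \<in> bergman_space" "h \<in> bergman_space"
  shows "bergman_inner h (\<lambda>z. \<Sum>i\<in>I. f i z) = (\<Sum>i\<in>I. bergman_inner h (f i))"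
  by (subst bergman_inner_commute, subst bergman_inner_sum_left[OF assms])
     (auto simp: bergman_inner_commute[of h])

lemma bergman_norm_square: "(bergman_norm f)\<^sup>2 = (LINT z:unit_disc|lborel. (cmod (f z))\<^sup>2) / pi"
  unfolding bergman_norm_def
  by (rule real_sqrt_pow2) (auto simp: set_lebesgue_integral_def intro!: divide_nonneg_nonneg integral_nonneg_AE)

lemma bergman_norm_nonneg [simp]: "bergman_norm f \<ge> 0"
  unfolding bergman_norm_def
  by (auto simp: set_lebesgue_integral_def intro!: divide_nonneg_nonneg integral_nonneg_AE)

lemma bergman_inner_self: "bergman_inner f f = of_real ((bergman_norm f)\<^sup>2)"
  unfolding bergman_norm_square bergman_inner_def
  by (simp add: complex_norm_square[symmetric] set_integral_complex_of_real[symmetric])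

lemma bergman_norm_scale: "bergman_norm (\<lambda>z. c * f z) = cmod c * bergman_norm f"
  by (simp add: bergman_norm_def norm_mult power_mult_distrib real_sqrt_mult
      flip: times_divide_eq_right)

lemma bergman_norm_divide: "bergman_norm (\<lambda>z. f z / c) = bergman_norm f / cmod c"
  using bergman_norm_scale[of "1 / c" f] by (simp add: norm_divide)

text \<open>One expansion with three uses: Cauchy-Schwarz, the triangle inequality
  (\<open>c = -1\<close>), and the Pythagorean step of Gram-Schmidt.\<close>

lemma bergman_norm_diff_scale:
  assumes "f \<in> bergman_space" "g \<in> bergman_space"
  shows "(bergman_norm (\<lambda>z. f z - c * g z))\<^sup>2
    = (bergman_norm f)\<^sup>2 - 2 * Re (cnj c * bergman_inner f g) + (cmod c)\<^sup>2 * (bergman_norm g)\<^sup>2"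
proof -
  have "complex_of_real ((bergman_norm (\<lambda>z. f z - c * g z))\<^sup>2)
      = bergman_inner f f - (cnj c * bergman_inner f g + cnj (cnj c * bergman_inner f g))
        + c * cnj c * bergman_inner g g"
    unfolding bergman_inner_self[symmetric]
    using assms
    by (simp add: bergman_inner_diff_left bergman_inner_diff_right bergman_inner_scale_left
        bergman_inner_scale_right bergman_space_intros bergman_inner_commute[of g f] algebra_simps)
  also have "\<dots> = complex_of_real ((bergman_norm f)\<^sup>2 - 2 * Re (cnj c * bergman_inner f g)
      + (cmod c)\<^sup>2 * (bergman_norm g)\<^sup>2)"
    unfolding complex_add_cnj bergman_inner_self complex_norm_square[symmetric] by simp
  finally show ?thesis using of_real_eq_iff by blast
qed

lemma bergman_Cauchy_Schwarz:
  assumes f: "f \<in> bergman_space" and g: "g \<in> bergman_space"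
  shows "cmod (bergman_inner f g) \<le> bergman_norm f * bergman_norm g"
proof -
  define I where "I = cmod (bergman_inner f g)"
  \<comment> \<open>This is nonnegativity of the squared norm of
    \<open>f - t * \<langle>f, g\<rangle> * g\<close> for real \<open>t\<close>.\<close>
  have *: "2 * t * I\<^sup>2 \<le> (bergman_norm f)\<^sup>2 + t\<^sup>2 * I\<^sup>2 * (bergman_norm g)\<^sup>2" for t :: real
  proof -
    have "0 \<le> (bergman_norm (\<lambda>z. f z - (of_real t * bergman_inner f g) * g z))\<^sup>2" by simp
    also have "\<dots> = (bergman_norm f)\<^sup>2 - 2 * (t * I\<^sup>2) + (t * I)\<^sup>2 * (bergman_norm g)\<^sup>2"
    proof -
      have "cnj (of_real t * bergman_inner f g) * bergman_inner f g = of_real (t * I\<^sup>2)"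
        unfolding of_real_mult I_def complex_norm_square by (simp add: mult_ac)
      moreover have "(cmod (of_real t * bergman_inner f g))\<^sup>2 = (t * I)\<^sup>2"
        by (simp add: I_def norm_mult power_mult_distrib)
      ultimately show ?thesis unfolding bergman_norm_diff_scale[OF f g] by (simp only: Re_complex_of_real)
    qed
    finally show ?thesis by (simp add: power_mult_distrib)
  qed
  have "I \<le> bergman_norm f * bergman_norm g"
  proof (cases "bergman_norm g = 0")
    case True
    have "I = 0"
    proof (rule ccontr)
      assume "I \<noteq> 0"
      \<comment> \<open>For \<open>bergman_norm g = 0\<close> the inequality \<open>*\<close> bounds
        \<open>2 * t * I ^ 2\<close> independently of \<open>t\<close>; this \<open>t\<close>
        exceeds the bound by 1.\<close>
      define t where "t = ((bergman_norm f)\<^sup>2 + 1) / (2 * I\<^sup>2)"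
      have "2 * t * I\<^sup>2 = (bergman_norm f)\<^sup>2 + 1"
        using \<open>I \<noteq> 0\<close> by (simp add: t_def)
      then show False
        using *[of t] unfolding True by simp
    qed
    then show ?thesis by simp
  next
    case False
    have "I\<^sup>2 \<le> (bergman_norm f)\<^sup>2 * (bergman_norm g)\<^sup>2"
    proof -
      have "2 * (I\<^sup>2 / (bergman_norm g)\<^sup>2) \<le> (bergman_norm f)\<^sup>2 + I\<^sup>2 / (bergman_norm g)\<^sup>2"
      proof -
        \<comment> \<open>The inequality \<open>*\<close> is applied at its optimal value
          \<open>t = 1 / u\<close>.\<close>
        define u where "u = (bergman_norm g)\<^sup>2"
        have "u \<noteq> 0" using False by (simp add: u_def)
        then have "(1 / u)\<^sup>2 * I\<^sup>2 * u = I\<^sup>2 / u" by (simp add: power2_eq_square)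
        then show ?thesis using *[of "1 / u"] unfolding u_def by simp
      qed
      then have "I\<^sup>2 / (bergman_norm g)\<^sup>2 \<le> (bergman_norm f)\<^sup>2" by linarith
      then show ?thesis using False by (simp add: divide_le_eq)
    qed
    then show ?thesis
      unfolding power_mult_distrib[symmetric] by (rule power2_le_imp_le) simp
  qed
  then show ?thesis by (simp add: I_def)
qed

lemma bergman_norm_triangle:
  assumes f: "f \<in> bergman_space" and g: "g \<in> bergman_space"
  shows "bergman_norm (\<lambda>z. f z + g z) \<le> bergman_norm f + bergman_norm g"
proof -
  have "(bergman_norm (\<lambda>z. f z + g z))\<^sup>2
      = (bergman_norm f)\<^sup>2 + 2 * Re (bergman_inner f g) + (bergman_norm g)\<^sup>2"
    using bergman_norm_diff_scale[OF f g, of "-1"] by simp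
  also have "\<dots> \<le> (bergman_norm f + bergman_norm g)\<^sup>2"
    using order_trans[OF complex_Re_le_cmod bergman_Cauchy_Schwarz[OF f g]]
    by (simp add: power2_sum)
  finally show ?thesis by (rule power2_le_imp_le) simp
qed

lemma bergman_norm_minus: "bergman_norm (\<lambda>z. g z - f z) = bergman_norm (\<lambda>z. f z - g z)"
  by (simp add: bergman_norm_def norm_minus_commute)

lemma bergman_norm_triangle_abs:
  assumes f: "f \<in> bergman_space" and g: "g \<in> bergman_space"
  shows "\<bar>bergman_norm f - bergman_norm g\<bar> \<le> bergman_norm (\<lambda>z. f z - g z)"
  using bergman_norm_triangle[OF bergman_space_diff[OF f g] g]
    bergman_norm_triangle[OF bergman_space_diff[OF g f] f] bergman_norm_minus[of g f]
  by simp

lemma measure_unit_disc: "measure lborel unit_disc = pi"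
  by (simp add: content_ball unit_ball_vol_2)

text \<open>Area is divided by \<open>pi\<close>, so the disc has total mass 1 and a pointwise bound
  passes to the norm with the same constant.\<close>

lemma bergman_norm_le:
  assumes "f holomorphic_on unit_disc" "\<And>z. z \<in> unit_disc \<Longrightarrow> cmod (f z) \<le> B"
  shows "bergman_norm f \<le> B"
proof -
  have B: "B \<ge> 0" using order_trans[OF norm_ge_zero assms(2)[of 0]] by simp
  have "f \<in> bergman_space" by (rule bergman_space_bounded[OF assms])
  then have "(LINT z:unit_disc|lborel. (cmod (f z))\<^sup>2) \<le> (LINT z:(unit_disc::complex set)|lborel. B\<^sup>2)"
    by (intro set_integral_mono)
       (auto simp: bergman_space_def intro!: power_mono assms(2) set_integrable_const_disc)
  also have "\<dots> = pi * B\<^sup>2"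
    using measure_unit_disc
    by (simp add: set_lebesgue_integral_def emeasure_lborel_ball_finite)
  finally have "(bergman_norm f)\<^sup>2 \<le> B\<^sup>2"
    by (simp add: bergman_norm_square divide_le_eq mult.commute)
  then show ?thesis using B by (rule power2_le_imp_le)
qed

section \<open>Moments of the area measure\<close>

lemma lborel_eq_distr_vec2: "lborel = distr lborel borel (\<lambda>x::real^2. Complex (x$1) (x$2))"
proof (rule lborel_eqI)
  fix l u :: complex
  assume le: "\<And>b. b \<in> Basis \<Longrightarrow> l \<bullet> b \<le> u \<bullet> b"
  let ?\<phi> = "\<lambda>x::real^2. Complex (x$1) (x$2)"
  let ?\<psi> = "\<lambda>z. vector [Re z, Im z] :: real^2"
  have [measurable]: "?\<phi> \<in> borel_measurable lborel"
    by (simp, intro borel_measurable_continuous_onI continuous_on_Complex continuous_intros)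
  have B: "(Basis :: (real^2) set) = {axis 1 1, axis 2 1}"
    by (auto simp: Basis_vec_def UNIV_2)
  have ne: "axis 1 1 \<noteq> (axis 2 1 :: real^2)" by (simp add: axis_eq_axis)
  have "?\<phi> -` box l u = box (?\<psi> l) (?\<psi> u)"
    by (auto simp: mem_box Basis_complex_def B inner_axis)
  moreover have "emeasure lborel (box (?\<psi> l) (?\<psi> u)) = (\<Prod>b\<in>Basis. (?\<psi> u - ?\<psi> l) \<bullet> b)"
    using le[of 1] le[of \<i>] by (intro emeasure_lborel_box) (auto simp: B inner_axis Basis_complex_def)
  moreover have "(\<Prod>b\<in>Basis. (?\<psi> u - ?\<psi> l) \<bullet> b) = (\<Prod>b\<in>Basis. (u - l) \<bullet> b)"
    using ne by (simp add: B inner_axis Basis_complex_def)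
  ultimately show "emeasure (distr lborel borel ?\<phi>) (box l u) = (\<Prod>b\<in>Basis. (u - l) \<bullet> b)"
    by (simp add: emeasure_distr)
qed simp

text \<open>
  \<^typ>\<open>complex\<close> is transported to \<^typ>\<open>real^2\<close> because the change of variables formula for
  orthogonal transformations is available for Cartesian spaces only.
\<close>

lemma lborel_eq_distr_rotation:
  fixes c :: complex
  assumes c: "cmod c = 1"
  shows "lborel = distr lborel borel (\<lambda>z. c * z)"
proof (rule lborel_eqI)
  fix l u :: complex
  assume le: "\<And>b. b \<in> Basis \<Longrightarrow> l \<bullet> b \<le> u \<bullet> b"
  define \<phi> where "\<phi> = (\<lambda>x::real^2. Complex (x$1) (x$2))"
  \<comment> \<open>Multiplication by \<open>cnj c\<close> in coordinates: the preimage of a box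
    under multiplication by \<open>c\<close> is the image under its inverse, and the invariance
    theorem speaks of images.\<close>
  define T where "T = (\<lambda>x::real^2. vector [Re (cnj c * \<phi> x), Im (cnj c * \<phi> x)] :: real^2)"
  have m[measurable]: "\<phi> \<in> borel_measurable borel"
    unfolding \<phi>_def by (intro borel_measurable_continuous_onI continuous_on_Complex continuous_intros)
  have [measurable]: "(\<lambda>z. c * z) \<in> borel_measurable borel" by simp
  have norm_\<phi>: "cmod (\<phi> x) = norm x" for x
    by (simp add: \<phi>_def norm_vec_def L2_set_def UNIV_2 cmod_def)
  have \<phi>T: "\<phi> (T x) = cnj c * \<phi> x" for x by (simp add: T_def \<phi>_def complex_eq_iff)
  have inj\<phi>: "x = y" if "\<phi> x = \<phi> y" for x y
    using that by (auto simp: \<phi>_def vec_eq_iff forall_2)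
  have surj\<phi>: "\<exists>x. \<phi> x = z" for z
    by (rule exI[of _ "vector [Re z, Im z]"]) (simp add: \<phi>_def)
  have "linear T"
    by (rule linearI) (auto simp: T_def \<phi>_def vec_eq_iff forall_2 algebra_simps)
  moreover have "norm (T x) = norm x" for x
    using \<phi>T[of x] c by (metis complex_mod_cnj mult_1 norm_\<phi> norm_mult)
  ultimately have T: "orthogonal_transformation T"
    by (simp add: orthogonal_transformation)
  have cc: "cnj c * c = 1" "c * cnj c = 1"
    using c complex_norm_square[of c] by (simp_all add: mult.commute)
  define X where "X = \<phi> -` box l u"
  have X: "X \<in> lmeasurable"
  proof -
    have "emeasure lborel X = emeasure (distr lborel borel \<phi>) (box l u)"
      by (simp add: emeasure_distr X_def)
    also have "\<dots> < \<infinity>"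
      using emeasure_lborel_box_finite[of l u] unfolding \<phi>_def lborel_eq_distr_vec2[symmetric] .
    finally show ?thesis
      by (intro fmeasurableI) (use measurable_sets[OF m, of "box l u"] in \<open>auto simp: X_def\<close>)
  qed
  have Teq: "\<phi> -` ((\<lambda>z. c * z) -` box l u) = T ` X"
  proof (intro set_eqI iffI)
    fix x assume "x \<in> \<phi> -` ((\<lambda>z. c * z) -` box l u)"
    then have "c * \<phi> x \<in> box l u" by simp
    obtain y where y: "\<phi> y = c * \<phi> x" using surj\<phi> by blast
    have "\<phi> (T y) = \<phi> x" using cc by (simp add: \<phi>T y mult.assoc[symmetric])
    then show "x \<in> T ` X" using inj\<phi> y \<open>c * \<phi> x \<in> box l u\<close> unfolding X_def by (metis image_eqI vimageI)
  next
    fix y assume "y \<in> T ` X"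
    then show "y \<in> \<phi> -` ((\<lambda>z. c * z) -` box l u)"
      using cc by (auto simp: \<phi>T X_def mult.assoc[symmetric])
  qed
  have "(\<lambda>x. c * \<phi> x) \<in> borel_measurable borel" by measurable
  from measurable_sets[OF this, of "box l u"] have TX: "T ` X \<in> sets borel"
    unfolding Teq[symmetric] by (simp add: vimage_def)
  have XB: "X \<in> sets borel" using measurable_sets[OF m, of "box l u"] by (simp add: X_def)
  have "emeasure (distr lborel borel (\<lambda>z. c * z)) (box l u)
      = emeasure lborel ((\<lambda>z. c * z) -` box l u)"
    by (simp add: emeasure_distr)
  also have "\<dots> = emeasure (distr lborel borel \<phi>) ((\<lambda>z. c * z) -` box l u)"
    unfolding \<phi>_def lborel_eq_distr_vec2[symmetric] ..
  also have "\<dots> = emeasure lborel (T ` X)"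
    unfolding Teq[symmetric]
    by (subst emeasure_distr) (use measurable_sets[of "(\<lambda>z. c * z)" borel borel "box l u"] in auto)
  also have "\<dots> = emeasure lebesgue (T ` X)"
    using TX by simp
  also have "\<dots> = emeasure lebesgue X"
    using measure_orthogonal_image[OF T X] measurable_orthogonal_image[OF T X] X
    by (simp add: emeasure_eq_measure2)
  also have "\<dots> = emeasure (distr lborel borel \<phi>) (box l u)"
    using XB by (simp add: emeasure_distr X_def)
  also have "\<dots> = emeasure lborel (box l u)"
    unfolding \<phi>_def lborel_eq_distr_vec2[symmetric] ..
  finally show "emeasure (distr lborel borel (\<lambda>z. c * z)) (box l u) = (\<Prod>b\<in>Basis. (u - l) \<bullet> b)"
    using le by simp
qed simp

lemma moment_off_diagonal:
  fixes r :: real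
  assumes "k \<noteq> j"
  shows "(LINT z:ball 0 r|lborel. z ^ k * cnj z ^ j) = 0"
proof -
  \<comment> \<open>With this angle, rotation by \<open>c\<close> multiplies
    \<open>z ^ k * cnj z ^ j\<close> by \<open>cis pi = -1\<close>, so the integral equals its own
    negative.\<close>
  define \<theta> where "\<theta> = pi / (real k - real j)"
  define c where "c = cis \<theta>"
  have c: "cmod c = 1" by (simp add: c_def)
  let ?f = "\<lambda>z. indicator (ball 0 r) z *\<^sub>R (z ^ k * cnj z ^ j)"
  have [measurable]: "?f \<in> borel_measurable borel"
    by (intro borel_measurable_continuous_on_indicator continuous_intros) auto
  have "c ^ k * cnj c ^ j = cis (real k * \<theta>) * cis (- (real j * \<theta>))"
    by (simp add: c_def Complex.DeMoivre cis_cnj)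
  also have "\<dots> = cis ((real k - real j) * \<theta>)" by (simp add: cis_mult left_diff_distrib)
  also have "(real k - real j) * \<theta> = pi" using assms by (simp add: \<theta>_def)
  finally have cc: "c ^ k * cnj c ^ j = -1" by simp
  have "(LINT z|lborel. ?f z) = (LINT z|distr lborel borel (\<lambda>z. c * z). ?f z)"
    using lborel_eq_distr_rotation[OF c] by simp
  also have "\<dots> = (LINT z|lborel. ?f (c * z))" by (rule integral_distr) measurable
  also have "\<dots> = (LINT z|lborel. (c ^ k * cnj c ^ j) * ?f z)"
    by (intro Bochner_Integration.integral_cong)
       (auto simp: indicator_def norm_mult c power_mult_distrib)
  also have "\<dots> = - (LINT z|lborel. ?f z)" unfolding cc by simp
  finally show ?thesis by (simp add: set_lebesgue_integral_def)
qed

text \<open>Substituting \<open>r * z\<close> for \<open>z\<close> gives \<open>r ^ n\<close> from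
  the integrand and a further factor \<open>r * r\<close> from the area.\<close>

lemma moment_scaling:
  fixes r :: real
  assumes "r > 0"
  shows "(LINT z:ball (0::complex) r|lborel. cmod z ^ n)
       = r ^ (n + 2) * (LINT z:ball (0::complex) 1|lborel. cmod z ^ n)"
proof -
  let ?f = "\<lambda>z::complex. indicator (ball 0 r) z *\<^sub>R cmod z ^ n"
  have [measurable]: "?f \<in> borel_measurable borel"
    by (intro borel_measurable_continuous_on_indicator continuous_intros) auto
  have "(LINT z|lborel. ?f z) = (LINT z|density (distr lborel borel (\<lambda>x. 0 + r *\<^sub>R x)) (\<lambda>_. \<bar>r\<bar>^DIM(complex)). ?f z)"
    using lborel_affine[of r "0::complex"] assms by simp
  also have "\<dots> = (LINT z|distr lborel borel (\<lambda>x. 0 + r *\<^sub>R x). r\<^sup>2 * ?f z)"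
    using \<open>?f \<in> borel_measurable borel\<close> assms by (subst integral_real_density[symmetric]) auto
  also have "\<dots> = (LINT z|lborel. r\<^sup>2 * ?f (0 + r *\<^sub>R z))"
    by (rule integral_distr) measurable
  also have "\<dots> = (LINT z|lborel. r ^ (n + 2) * (indicator (ball (0::complex) 1) z *\<^sub>R cmod z ^ n))"
    using assms by (intro Bochner_Integration.integral_cong)
       (auto simp: indicator_def power_mult_distrib power_add power2_eq_square)
  finally show ?thesis by (simp add: set_lebesgue_integral_def)
qed

lemma set_integrable_continuous_ball:
  fixes h :: "complex \<Rightarrow> 'b::{banach, second_countable_topology}"
  assumes "continuous_on UNIV h"
  shows "set_integrable lborel (ball 0 r) h"
proof -
  have "set_integrable lborel (cball 0 r) h"
    unfolding set_integrable_def
    by (rule borel_integrable_compact) (use assms continuous_on_subset in auto)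
  then show ?thesis by (rule set_integrable_subset) auto
qed

lemma integral_ball_const:
  "r \<ge> 0 \<Longrightarrow> (LINT z:ball (0::complex) r|lborel. c::real) = c * (pi * r\<^sup>2)"
  using emeasure_lborel_ball_finite[of "0::complex" r]
  by (simp add: set_lebesgue_integral_def content_ball unit_ball_vol_2)

text \<open>
  In place of polar coordinates: by scaling, the integral over the annulus \<open>r \<le> cmod z < 1\<close> is
  \<open>(1 - r ^ (2 * j + 2)) * M 1\<close>, and bounding the integrand there and letting \<open>r \<rightarrow> 1\<close> yields \<open>M 1\<close>.
\<close>

lemma moment_unit_disc: "(LINT z:unit_disc|lborel. cmod z ^ (2 * j)) = pi / (real j + 1)"
proof -
  define M where "M r = (LINT z:ball (0::complex) r|lborel. cmod z ^ (2 * j))" for r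
  have mono: "(LINT z:ball 0 r|lborel. h z) \<le> (LINT z:unit_disc|lborel. h z)"
    if "0 < r" "r < 1" "continuous_on UNIV h" "\<And>z. r \<le> cmod z \<Longrightarrow> cmod z < 1 \<Longrightarrow> h z \<ge> 0"
    for h :: "complex \<Rightarrow> real" and r
    unfolding set_lebesgue_integral_def
    using set_integrable_continuous_ball[OF that(3)] that(1,2,4)
    by (intro integral_mono) (auto simp: set_integrable_def indicator_def)
  have bounds: "M 1 * (\<Sum>i<Suc j. (r\<^sup>2) ^ i) \<le> pi" "pi * r ^ (2 * j) \<le> M 1 * (\<Sum>i<Suc j. (r\<^sup>2) ^ i)"
    if r: "0 < r" "r < 1" for r
  proof -
    have Mr: "M r = r ^ (2 * j + 2) * M 1"
      unfolding M_def by (rule moment_scaling[OF r(1)])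
    have int: "set_integrable lborel (ball (0::complex) s) (\<lambda>z. cmod z ^ (2 * j))" for s
      by (intro set_integrable_continuous_ball continuous_intros)
    have intc: "set_integrable lborel (ball (0::complex) s) (\<lambda>z. c::real)" for s c
      by (intro set_integrable_continuous_ball continuous_intros)
    have "1 * (pi * r\<^sup>2) - M r \<le> 1 * (pi * 1\<^sup>2) - M 1"
      using mono[OF r, of "\<lambda>z. 1 - cmod z ^ (2 * j)"] r
      unfolding set_integral_diff(2)[OF intc int] integral_ball_const[OF less_imp_le[OF r(1)]] integral_ball_const[OF zero_le_one] M_def
      by (force intro!: continuous_intros power_le_one)
    then have up: "M 1 * (1 - (r\<^sup>2) ^ Suc j) \<le> pi * (1 - r\<^sup>2)"
      unfolding Mr power_mult[symmetric] by (simp add: algebra_simps power2_eq_square)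
    have "M r - r ^ (2 * j) * (pi * r\<^sup>2) \<le> M 1 - r ^ (2 * j) * (pi * 1\<^sup>2)"
      using mono[OF r, of "\<lambda>z. cmod z ^ (2 * j) - r ^ (2 * j)"] r
      unfolding set_integral_diff(2)[OF int intc] integral_ball_const[OF less_imp_le[OF r(1)]] integral_ball_const[OF zero_le_one] M_def
      by (force intro!: continuous_intros power_mono)
    then have lo: "pi * r ^ (2 * j) * (1 - r\<^sup>2) \<le> M 1 * (1 - (r\<^sup>2) ^ Suc j)"
      unfolding Mr power_mult[symmetric] by (simp add: algebra_simps power2_eq_square)
    \<comment> \<open>Both estimates contain the factor \<open>1 - r * r\<close>, on the right
      through the geometric sum. Once it is cancelled they stay informative as \<open>r\<close>
      tends to 1.\<close>
    have p: "1 - r\<^sup>2 > 0" using r by (simp add: power_less_one_iff)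
    show "M 1 * (\<Sum>i<Suc j. (r\<^sup>2) ^ i) \<le> pi"
      using up p unfolding one_diff_power_eq[of "r\<^sup>2"]
      by (metis mult.left_commute mult.commute mult_le_cancel_left_pos)
    show "pi * r ^ (2 * j) \<le> M 1 * (\<Sum>i<Suc j. (r\<^sup>2) ^ i)"
      using lo p unfolding one_diff_power_eq[of "r\<^sup>2"]
      by (metis mult.left_commute mult.commute mult_le_cancel_left_pos)
  qed
  have ev: "eventually (\<lambda>r. 0 < r \<and> r < (1::real)) (at_left 1)"
    using eventually_at_left_real[of 0 "1::real"] by simp
  have lim: "((\<lambda>r::real. M 1 * (\<Sum>i<Suc j. (r\<^sup>2) ^ i)) \<longlongrightarrow> M 1 * (\<Sum>i<Suc j. (1\<^sup>2) ^ i)) (at_left 1)"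
    by (intro tendsto_intros)
  have lim2: "((\<lambda>r::real. pi * r ^ (2 * j)) \<longlongrightarrow> pi * 1 ^ (2 * j)) (at_left 1)"
    by (intro tendsto_intros)
  have "M 1 * (\<Sum>i<Suc j. (1\<^sup>2) ^ i) \<le> pi"
    by (rule tendsto_upperbound[OF lim]) (use ev bounds(1) in \<open>auto elim: eventually_mono\<close>)
  moreover have "pi * 1 ^ (2 * j) \<le> M 1 * (\<Sum>i<Suc j. (1\<^sup>2) ^ i)"
    by (rule tendsto_le[OF _ lim lim2]) (use ev bounds(2) in \<open>auto elim: eventually_mono\<close>)
  ultimately have "M 1 * (real j + 1) = pi" by (simp add: algebra_simps)
  then show ?thesis unfolding M_def by (simp add: field_simps add_nonneg_eq_0_iff)
qed

lemma moment_diagonal: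
  fixes r :: real
  assumes "r > 0"
  shows "(LINT z:ball 0 r|lborel. z ^ j * cnj z ^ j) = of_real (pi * r ^ (2 * j + 2) / (real j + 1))"
proof -
  have "z ^ j * cnj z ^ j = of_real (cmod z ^ (2 * j))" for z
    by (metis complex_norm_square of_real_power power_mult power_mult_distrib)
  then have "(LINT z:ball 0 r|lborel. z ^ j * cnj z ^ j) = of_real (LINT z:ball (0::complex) r|lborel. cmod z ^ (2 * j))"
    by (simp only: set_integral_complex_of_real)
  then show ?thesis by (simp add: moment_scaling[OF assms] moment_unit_disc)
qed

section \<open>The reproducing property\<close>

text \<open>Termwise integration under a majorant that splits into a summable factor
  \<open>C i\<close> and an integrable factor \<open>g z\<close>. It is used on a smaller disc with
  constant \<open>g\<close> and on the whole disc with \<open>g z = cmod (f z)\<close>.\<close>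

lemma set_integral_sums_dominated:
  fixes f :: "nat \<Rightarrow> complex \<Rightarrow> complex" and g :: "complex \<Rightarrow> real"
  assumes A: "A \<in> sets lborel" and g: "set_integrable lborel A g"
    and f: "\<And>i. set_borel_measurable lborel A (f i)"
    and le: "\<And>i z. z \<in> A \<Longrightarrow> cmod (f i z) \<le> C i * g z"
    and C: "summable C" 
    and sums: "\<And>z. z \<in> A \<Longrightarrow> (\<lambda>i. f i z) sums F z"
  shows "(\<lambda>i. LINT z:A|lborel. f i z) sums (LINT z:A|lborel. F z)"
proof -
  have int: "set_integrable lborel A (f i)" for i
  proof (rule set_integrable_bound[OF _ f])
    show "set_integrable lborel A (\<lambda>z. C i * g z)" using g by simp
    show "AE x in lborel. x \<in> A \<longrightarrow> norm (f i x) \<le> norm (C i * g x)"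
      using le[of _ i] by (intro AE_I2) (auto intro: order_trans abs_ge_self)
  qed
  have "(\<lambda>i. LINT z|lborel. indicator A z *\<^sub>R f i z) sums (LINT z|lborel. (\<Sum>i. indicator A z *\<^sub>R f i z))"
  proof (rule sums_integral)
    show "integrable lborel (\<lambda>z. indicator A z *\<^sub>R f i z)" for i
      using int by (simp add: set_integrable_def)
    show "AE z in lborel. summable (\<lambda>i. norm (indicator A z *\<^sub>R f i z))"
    proof (intro AE_I2)
      fix z
      have "summable (\<lambda>i. C i * g z)" using C by (rule summable_mult2)
      then have "summable (\<lambda>i. cmod (f i z))" if "z \<in> A"
        by (rule summable_comparison_test') (use le that in auto)
      then show "summable (\<lambda>i. norm (indicator A z *\<^sub>R f i z))"
        by (cases "z \<in> A") auto
    qed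
    show "summable (\<lambda>i. LINT z|lborel. norm (indicator A z *\<^sub>R f i z))"
    proof (rule summable_comparison_test')
      show "summable (\<lambda>i. C i * (LINT z:A|lborel. g z))" using C by (rule summable_mult2)
      show "norm (LINT z|lborel. norm (indicator A z *\<^sub>R f i z)) \<le> C i * (LINT z:A|lborel. g z)" for i
      proof -
        have "(LINT z|lborel. norm (indicator A z *\<^sub>R f i z)) \<le> (LINT z|lborel. C i * (indicator A z *\<^sub>R g z))"
        proof (rule integral_mono)
          show "integrable lborel (\<lambda>z. norm (indicator A z *\<^sub>R f i z))"
            using int[of i] unfolding set_integrable_def by (rule integrable_norm)
          show "integrable lborel (\<lambda>z. C i * (indicator A z *\<^sub>R g z))"
            using g unfolding set_integrable_def by (rule integrable_mult_right)
          show "norm (indicator A z *\<^sub>R f i z) \<le> C i * (indicator A z *\<^sub>R g z)" for z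
            using le[of z i] by (auto simp: indicator_def)
        qed
        then show ?thesis by (simp add: set_lebesgue_integral_def)
      qed
    qed
  qed
  moreover have "(\<Sum>i. indicator A z *\<^sub>R f i z) = indicator A z *\<^sub>R F z" for z
    using sums_unique[OF sums[of z]] by (cases "z \<in> A") auto
  ultimately show ?thesis by (simp add: set_lebesgue_integral_def)
qed

text \<open>Orthogonality leaves only the \<open>j\<close>-th Taylor term. Staying at radius
  \<open>r < 1\<close> makes the Taylor series of \<open>f\<close> dominated by a summable
  sequence.\<close>

lemma integral_ball_monomial:
  assumes f: "f holomorphic_on unit_disc" and r: "0 < r" "r < 1"
  shows "(LINT z:ball 0 r|lborel. f z * cnj z ^ j)
    = (deriv ^^ j) f 0 / fact j * of_real (pi * r ^ (2 * j + 2) / (real j + 1))"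
proof -
  define c where "c i = (deriv ^^ i) f 0 / fact i" for i
  have f_sums: "(\<lambda>i. c i * z ^ i) sums f z" if "z \<in> unit_disc" for z
    using holomorphic_power_series[OF f that] by (simp add: c_def)
  \<comment> \<open>Convergence at a point of modulus \<open>s > r\<close> makes the power series
    absolutely convergent at \<open>r\<close>.\<close>
  obtain s where s: "r < s" "s < 1" using r dense by blast
  have "summable (\<lambda>i. c i * of_real s ^ i)"
    using f_sums[of "of_real s"] s r by (intro sums_summable) auto
  then have C: "summable (\<lambda>i. norm (c i * of_real r ^ i))"
    by (rule powser_insidea) (use s r in auto)
  have "(\<lambda>i. LINT z:ball 0 r|lborel. c i * z ^ i * cnj z ^ j) sums (LINT z:ball 0 r|lborel. f z * cnj z ^ j)"
  proof (rule set_integral_sums_dominated[where g = "\<lambda>_. 1" and C = "\<lambda>i. norm (c i * of_real r ^ i)"])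
    show "set_integrable lborel (ball (0::complex) r) (\<lambda>_. 1::real)"
      by (intro set_integrable_continuous_ball continuous_intros)
    show "set_borel_measurable lborel (ball 0 r) (\<lambda>z. c i * z ^ i * cnj z ^ j)" for i
      unfolding set_borel_measurable_def measurable_lborel2
      by (intro borel_measurable_continuous_on_indicator continuous_intros) auto
    show "(\<lambda>i. c i * z ^ i * cnj z ^ j) sums (f z * cnj z ^ j)" if "z \<in> ball 0 r" for z
      using that r by (intro sums_mult2 f_sums) auto
    show "cmod (c i * z ^ i * cnj z ^ j) \<le> norm (c i * of_real r ^ i) * 1" if "z \<in> ball 0 r" for i z
    proof -
      have "cmod z ^ i \<le> r ^ i" "cmod z ^ j \<le> 1"
        using that r by (auto intro: power_mono power_le_one)
      then have "cmod (c i) * (cmod z ^ i * cmod z ^ j) \<le> cmod (c i) * (r ^ i * 1)"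
        using r by (intro mult_mono) auto
      then show ?thesis using r by (simp add: norm_mult norm_power mult.assoc)
    qed
  qed (use C in auto)
  moreover have "(LINT z:ball 0 r|lborel. c i * z ^ i * cnj z ^ j)
      = (if i = j then c i * of_real (pi * r ^ (2 * i + 2) / (real i + 1)) else 0)" for i
    using moment_off_diagonal[of i j r] moment_diagonal[OF r(1), of j] by (simp add: mult.assoc)
  ultimately have "(\<lambda>i. if i = j then c i * of_real (pi * r ^ (2 * i + 2) / (real i + 1)) else 0)
      sums (LINT z:ball 0 r|lborel. f z * cnj z ^ j)" by simp
  from sums_unique2[OF this sums_single] show ?thesis by (simp add: c_def)
qed

lemma power_in_bergman_space: "(\<lambda>z. z ^ j) \<in> bergman_space"
  by (rule bergman_space_bounded[where B = 1])
     (auto intro!: holomorphic_intros power_le_one simp: norm_power)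

lemma bergman_inner_power:
  assumes f: "f \<in> bergman_space"
  shows "bergman_inner f (\<lambda>z. z ^ j) = (deriv ^^ j) f 0 / fact j / (of_nat j + 1)"
proof -
  \<comment> \<open>The radii \<open>1/2, 2/3, 3/4, ...\<close> increase to 1; the shift by 2 keeps
    the first one positive.\<close>
  define r where "r n = 1 - inverse (real (Suc (Suc n)))" for n :: nat
  have r: "0 < r n" "r n < 1" for n by (auto simp: r_def field_simps)
  have r_lim: "r \<longlonglongrightarrow> 1"
    unfolding r_def using tendsto_diff[OF tendsto_const LIMSEQ_Suc[OF LIMSEQ_inverse_real_of_nat], of 1] by simp
  have inc: "incseq r" unfolding r_def by (auto simp: incseq_def field_simps)
  have U: "(\<Union>n. ball (0::complex) (r n)) = unit_disc"
  proof (intro set_eqI iffI)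
    fix z :: complex assume "z \<in> unit_disc"
    then have "eventually (\<lambda>n. cmod z < r n) sequentially"
      using order_tendstoD(1)[OF r_lim] by simp
    then show "z \<in> (\<Union>n. ball 0 (r n))" by (auto simp: eventually_sequentially)
  next
    fix z :: complex assume "z \<in> (\<Union>n. ball 0 (r n))"
    then show "z \<in> unit_disc" using r(2) by (auto intro: less_trans)
  qed
  have "(\<lambda>n. LINT z:ball 0 (r n)|lborel. f z * cnj z ^ j)
      \<longlonglongrightarrow> (LINT z:(\<Union>n. ball 0 (r n))|lborel. f z * cnj z ^ j)"
  proof (rule set_integral_cont_up)
    show "incseq (\<lambda>n. ball (0::complex) (r n))"
      using inc by (auto simp: incseq_def intro!: subset_ball)
    show "set_integrable lborel (\<Union>n. ball 0 (r n)) (\<lambda>z. f z * cnj z ^ j)"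
      using bergman_integrable_mult[OF f power_in_bergman_space[of j]] by (simp add: U)
  qed simp
  moreover have "(\<lambda>n. LINT z:ball 0 (r n)|lborel. f z * cnj z ^ j)
      \<longlonglongrightarrow> (deriv ^^ j) f 0 / fact j * of_real (pi * 1 ^ (2 * j + 2) / (real j + 1))"
    unfolding integral_ball_monomial[OF bergman_space_holomorphic[OF f] r]
    by (intro tendsto_intros r_lim) (use of_nat_0_le_iff[of j] in linarith)
  ultimately have "(LINT z:unit_disc|lborel. f z * cnj z ^ j)
      = (deriv ^^ j) f 0 / fact j * of_real (pi / (real j + 1))"
    unfolding U using LIMSEQ_unique by fastforce
  then show ?thesis by (simp add: bergman_inner_def add.commute)
qed

lemma kernel_denominator:
  assumes "w \<in> unit_disc" "z \<in> unit_disc"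
  shows "1 - cmod w \<le> cmod (1 - cnj w * z)"
proof -
  have "cmod (cnj w * z) \<le> cmod w" using assms by (simp add: norm_mult mult_left_le)
  then show ?thesis using norm_triangle_ineq2[of 1 "cnj w * z"] by simp
qed

lemma bergman_kernel_in_space:
  assumes w: "w \<in> unit_disc"
  shows "kernel_at w \<in> bergman_space"
proof (rule bergman_space_bounded)
  have nz: "1 - cnj w * z \<noteq> 0" if "z \<in> unit_disc" for z
    using kernel_denominator[OF w that] w by auto
  then show "kernel_at w holomorphic_on unit_disc"
    unfolding bergman_kernel_def by (intro holomorphic_intros) auto
  show "cmod (bergman_kernel z w) \<le> 1 / (1 - cmod w)\<^sup>2" if "z \<in> unit_disc" for z
    unfolding bergman_kernel_def norm_divide norm_power norm_one
    using kernel_denominator[OF w that] w by (intro divide_left_mono power_mono mult_pos_pos zero_less_power) auto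
qed

text \<open>Here the kernel is expanded, not \<open>f\<close>: its terms
  \<open>(j + 1) * w ^ j * cnj z ^ j\<close> are bounded by \<open>(j + 1) * cmod w ^ j\<close> on
  the whole disc, so integrability of \<open>f\<close> justifies the exchange. The weight
  \<open>j + 1\<close> cancels the denominator in \<open>bergman_inner_power\<close>, and the Taylor
  series of \<open>f\<close> at \<open>w\<close> remains.\<close>

theorem bergman_reproducing:
  assumes f: "f \<in> bergman_space" and w: "w \<in> unit_disc"
  shows "bergman_inner f (kernel_at w) = f w"
proof -
  have "(\<lambda>j. LINT z:unit_disc|lborel. of_nat (Suc j) * w ^ j * (f z * cnj z ^ j))
      sums (LINT z:unit_disc|lborel. f z * cnj (bergman_kernel z w))"
  proof (rule set_integral_sums_dominated[where g = "\<lambda>z. cmod (f z)"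
        and C = "\<lambda>j. norm (of_nat (Suc j) * w ^ j)"])
    have "set_integrable lborel unit_disc (\<lambda>z. f z * cnj (z ^ 0))"
      by (rule bergman_integrable_mult[OF f power_in_bergman_space])
    then show "set_integrable lborel unit_disc (\<lambda>z. cmod (f z))"
      by (simp add: set_integrable_norm)
    show "set_borel_measurable lborel unit_disc (\<lambda>z. of_nat (Suc i) * w ^ i * (f z * cnj z ^ i))" for i
      by (intro continuous_set_borel_measurable continuous_intros holomorphic_on_imp_continuous_on
          bergman_space_holomorphic f)
    show "cmod (of_nat (Suc i) * w ^ i * (f z * cnj z ^ i)) \<le> cmod (of_nat (Suc i) * w ^ i) * cmod (f z)"
      if "z \<in> unit_disc" for i z
      using that unfolding norm_mult
      by (intro mult_left_mono mult_left_le) (auto simp: norm_power intro!: power_le_one)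
    obtain s where s: "cmod w < s" "s < 1" using w dense by auto
    have "summable (\<lambda>j. of_nat (Suc j) * (of_real s :: complex) ^ j)"
      using geometric_deriv_sums[of "of_real s :: complex"] s norm_ge_zero[of w] by (intro sums_summable) auto
    then show "summable (\<lambda>j. norm (of_nat (Suc j) * w ^ j))"
      by (rule powser_insidea) (use s norm_ge_zero[of w] in auto)
    show "(\<lambda>i. of_nat (Suc i) * w ^ i * (f z * cnj z ^ i)) sums (f z * cnj (bergman_kernel z w))"
      if z: "z \<in> unit_disc" for z
    proof -
      have "cmod (w * cnj z) < 1" 
        using z w mult_strict_mono[of "cmod w" 1 "cmod z" 1] by (simp add: norm_mult)
      from sums_mult[OF geometric_deriv_sums[OF this], of "f z"] show ?thesis
        by (simp add: bergman_kernel_def power_mult_distrib mult_ac)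
    qed
  qed simp
  from sums_divide[OF this, of "of_real pi"]
  have "(\<lambda>j. of_nat (Suc j) * w ^ j * bergman_inner f (\<lambda>z. z ^ j)) sums bergman_inner f (kernel_at w)"
    by (simp add: bergman_inner_def)
  moreover have "of_nat (Suc j) * w ^ j * bergman_inner f (\<lambda>z. z ^ j) = (deriv ^^ j) f 0 / fact j * w ^ j" for j
  proof -
    have "of_nat j + 1 \<noteq> (0 :: complex)" using of_nat_neq_0[of j] by (simp add: add.commute)
    then show ?thesis unfolding bergman_inner_power[OF f] by (simp add: add.commute)
  qed
  ultimately have "(\<lambda>j. (deriv ^^ j) f 0 / fact j * w ^ j) sums bergman_inner f (kernel_at w)" by simp
  then show ?thesis
    using holomorphic_power_series[OF bergman_space_holomorphic[OF f] w] sums_unique2 by force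
qed

text \<open>Boundedness of point evaluations gives definiteness of the norm and turns norm
  convergence into pointwise convergence.\<close>

lemma bergman_point_evaluation:
  assumes "f \<in> bergman_space" "w \<in> unit_disc"
  shows "cmod (f w) \<le> bergman_norm f * bergman_norm (kernel_at w)"
  using bergman_Cauchy_Schwarz[OF assms(1) bergman_kernel_in_space[OF assms(2)]] bergman_reproducing[OF assms]
  by simp

lemma bergman_norm_eq_0_imp:
  assumes "f \<in> bergman_space" "bergman_norm f = 0" "z \<in> unit_disc"
  shows "f z = 0"
  using bergman_point_evaluation[OF assms(1,3)] assms(2) by simp

section \<open>Orthogonal projections and Gram--Schmidt\<close>

text \<open>The predicate under the choice in \<open>proj_preceding\<close>, named so that existence
  and uniqueness can be stated separately.\<close>

definition is_projection ::
    "(nat \<Rightarrow> complex \<Rightarrow> complex) \<Rightarrow> nat \<Rightarrow> (complex \<Rightarrow> complex) \<Rightarrow> (complex \<Rightarrow> complex) \<Rightarrow> bool" where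
  "is_projection v n f p \<longleftrightarrow> (\<exists>c. p = (\<lambda>z. \<Sum>j\<in>{1..<n}. c j * v j z)) \<and>
     (\<forall>j\<in>{1..<n}. bergman_inner (\<lambda>z. f z - p z) (v j) = 0)"

locale bergman_sequence =
  fixes v :: "nat \<Rightarrow> complex \<Rightarrow> complex"
  assumes v_in_space: "\<And>j. j \<ge> 1 \<Longrightarrow> v j \<in> bergman_space"
begin

lemma combination_in_space: "(\<lambda>z. \<Sum>j\<in>{1..<n}. c j * v j z) \<in> bergman_space"
  by (intro bergman_space_sum bergman_space_scale v_in_space) simp

lemma is_projection_in_space: "is_projection v n f p \<Longrightarrow> p \<in> bergman_space"
  using combination_in_space by (auto simp: is_projection_def)

lemma is_projection_orthogonal:
  assumes p: "is_projection v n f p" and f: "f \<in> bergman_space"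
  shows "bergman_inner (\<lambda>z. f z - p z) (\<lambda>z. \<Sum>j\<in>{1..<n}. c j * v j z) = 0"
proof -
  have "bergman_inner (\<lambda>z. f z - p z) (\<lambda>z. \<Sum>j\<in>{1..<n}. c j * v j z)
      = (\<Sum>j\<in>{1..<n}. bergman_inner (\<lambda>z. f z - p z) (\<lambda>z. c j * v j z))"
    by (intro bergman_inner_sum_right bergman_space_intros f is_projection_in_space[OF p] v_in_space) auto
  also have "\<dots> = 0"
    using p by (intro sum.neutral) (auto simp: is_projection_def bergman_inner_scale_right)
  finally show ?thesis .
qed

text \<open>The difference \<open>p - q = (f - q) - (f - p)\<close> lies in the span and is
  orthogonal to it, so its norm is 0.\<close>

lemma is_projection_unique:
  assumes p: "is_projection v n f p" and q: "is_projection v n f q" and f: "f \<in> bergman_space"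
    and z: "z \<in> unit_disc"
  shows "p z = q z"
proof -
  obtain c d where c: "p = (\<lambda>z. \<Sum>j\<in>{1..<n}. c j * v j z)" and d: "q = (\<lambda>z. \<Sum>j\<in>{1..<n}. d j * v j z)"
    using p q by (auto simp: is_projection_def)
  note ps = is_projection_in_space[OF p] and qs = is_projection_in_space[OF q]
  have pq: "(\<lambda>z. p z - q z) = (\<lambda>z. \<Sum>j\<in>{1..<n}. (c j - d j) * v j z)"
    by (simp add: c d sum_subtractf left_diff_distrib)
  have "bergman_inner (\<lambda>z. (f z - q z) - (f z - p z)) (\<lambda>z. p z - q z) = 0"
    using is_projection_orthogonal[OF q f, of "\<lambda>j. c j - d j"] is_projection_orthogonal[OF p f, of "\<lambda>j. c j - d j"]
    by (subst bergman_inner_diff_left) (simp_all add: pq[symmetric] bergman_space_diff f ps qs del: One_nat_def)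
  then have "bergman_norm (\<lambda>z. p z - q z) = 0"
    using bergman_inner_self[of "\<lambda>z. p z - q z"] by simp
  from bergman_norm_eq_0_imp[OF bergman_space_diff[OF ps qs] this z] show ?thesis by simp
qed

text \<open>
  If \<open>v n\<close> already lies in the span of its predecessors, then \<open>B\<close> is the zero function because of
  \<open>x / 0 = 0\<close>, so \<open>B\<close> has norm 1 or 0.
\<close>

lemma is_projection_Suc:
  assumes n: "n \<ge> 1" and q: "is_projection v n (v n) q"
    and p: "is_projection v n f p" and f: "f \<in> bergman_space"
  defines "N \<equiv> bergman_norm (\<lambda>z. v n z - q z)"
  defines "B \<equiv> (\<lambda>z. (v n z - q z) / of_real N)"
  shows "is_projection v (Suc n) f (\<lambda>z. p z + bergman_inner f B * B z)"
    and "(bergman_norm (\<lambda>z. f z - (p z + bergman_inner f B * B z)))\<^sup>2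
       = (bergman_norm (\<lambda>z. f z - p z))\<^sup>2 - (cmod (bergman_inner f B))\<^sup>2"
proof -
  obtain c where c: "p = (\<lambda>z. \<Sum>j\<in>{1..<n}. c j * v j z)"
    using p by (auto simp: is_projection_def)
  obtain d where d: "q = (\<lambda>z. \<Sum>j\<in>{1..<n}. d j * v j z)"
    using q by (auto simp: is_projection_def)
  note vs = v_in_space[OF n]
  note ps = is_projection_in_space[OF p] and qs = is_projection_in_space[OF q]
  have Bs: "B \<in> bergman_space" unfolding B_def by (intro bergman_space_intros vs qs)
  define \<gamma> where "\<gamma> = bergman_inner f B"
  have Bn: "bergman_norm B = 1 \<or> (N = 0 \<and> B = (\<lambda>z. 0))"
    by (cases "N = 0") (auto simp: B_def bergman_norm_divide N_def)
  have B_orth: "bergman_inner B (\<lambda>z. \<Sum>j\<in>{1..<n}. e j * v j z) = 0" for e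
    unfolding B_def bergman_inner_divide_left is_projection_orthogonal[OF q vs] by simp
  then have B_orth': "bergman_inner (\<lambda>z. \<Sum>j\<in>{1..<n}. e j * v j z) B = 0" for e
    using bergman_inner_commute[of B] by simp
  have fpB: "bergman_inner (\<lambda>z. f z - p z) B = \<gamma>"
    using bergman_inner_diff_left[OF f ps Bs] B_orth'[of c] by (simp add: \<gamma>_def c)
  have \<gamma>_cases: "bergman_norm B = 1 \<or> \<gamma> = 0"
    using Bn bergman_inner_commute[of f "\<lambda>z. 0"] by (auto simp: \<gamma>_def bergman_inner_zero_left)
  \<comment> \<open>For \<open>N = 0\<close> definiteness gives \<open>v n = q\<close> on the disc,
    in accordance with \<open>B = 0\<close>.\<close>
  have vn: "v n z = q z + of_real N * B z" if "z \<in> unit_disc" for z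
    using bergman_norm_eq_0_imp[OF bergman_space_diff[OF vs qs] _ that] Bn
    by (cases "N = 0") (auto simp: B_def N_def)
  have eq: "(\<lambda>z. f z - (p z + \<gamma> * B z)) = (\<lambda>z. (f z - p z) - \<gamma> * B z)" by auto
  have res_B: "bergman_inner (\<lambda>z. f z - (p z + \<gamma> * B z)) B = 0"
    unfolding eq using \<gamma>_cases
    by (subst bergman_inner_diff_left)
       (auto intro!: bergman_space_intros f ps Bs simp: fpB bergman_inner_scale_left bergman_inner_self)
  have res_low: "bergman_inner (\<lambda>z. f z - (p z + \<gamma> * B z)) (\<lambda>z. \<Sum>j\<in>{1..<n}. e j * v j z) = 0" for e
    unfolding eq
    by (subst bergman_inner_diff_left)
       (simp_all add: bergman_space_diff bergman_space_scale combination_in_space f ps Bs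
          is_projection_orthogonal[OF p f] bergman_inner_scale_left B_orth del: One_nat_def)
  have res_vn: "bergman_inner (\<lambda>z. f z - (p z + \<gamma> * B z)) (v n) = 0"
  proof -
    have "bergman_inner (\<lambda>z. f z - (p z + \<gamma> * B z)) (v n)
        = bergman_inner (\<lambda>z. f z - (p z + \<gamma> * B z)) (\<lambda>z. q z + of_real N * B z)"
      by (rule bergman_inner_cong) (auto simp: vn)
    also have "\<dots> = bergman_inner (\<lambda>z. f z - (p z + \<gamma> * B z)) q"
      by (subst bergman_inner_add_right)
         (auto intro!: bergman_space_intros f ps qs Bs simp: res_B bergman_inner_scale_right)
    also have "\<dots> = 0" using res_low[of d] unfolding d .
    finally show ?thesis .
  qed
  have res_vj: "bergman_inner (\<lambda>z. f z - (p z + \<gamma> * B z)) (v j) = 0" if "j \<in> {1..<n}" for j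
  proof -
    have "(\<lambda>z. \<Sum>i\<in>{1..<n}. (if i = j then 1 else 0) * v i z) = v j"
      using that by (simp add: if_distrib[of "\<lambda>x. x * _"] cong: if_cong)
    then show ?thesis using res_low[of "\<lambda>i. if i = j then 1 else 0"] by simp
  qed
  \<comment> \<open>The coefficients come from writing \<open>B\<close> as
    \<open>(v n - q) / N\<close>; for \<open>N = 0\<close> the quotient \<open>\<gamma> / N\<close>
    is 0 and they reduce to those of \<open>p\<close>.\<close>
  define e where "e j = (if j = n then \<gamma> / of_real N else c j - \<gamma> / of_real N * d j)" for j
  have "p z + \<gamma> * B z = (\<Sum>j\<in>{1..<Suc n}. e j * v j z)" for z
  proof -
    have "(\<Sum>j\<in>{1..<Suc n}. e j * v j z) = (\<Sum>j\<in>{1..<n}. (c j - \<gamma> / of_real N * d j) * v j z) + \<gamma> / of_real N * v n z"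
      using n by (simp add: e_def)
    also have "\<dots> = p z - \<gamma> / of_real N * q z + \<gamma> / of_real N * v n z"
      by (simp add: c d left_diff_distrib sum_subtractf sum_distrib_left mult.assoc)
    also have "\<dots> = p z + \<gamma> * B z" by (simp add: B_def diff_divide_distrib right_diff_distrib)
    finally show ?thesis by simp
  qed
  then show "is_projection v (Suc n) f (\<lambda>z. p z + bergman_inner f B * B z)"
    using res_vn res_vj n unfolding is_projection_def \<gamma>_def[symmetric]
    by (auto simp: atLeastLessThanSuc)
  have "(cmod \<gamma>)\<^sup>2 * (bergman_norm B)\<^sup>2 = (cmod \<gamma>)\<^sup>2"
    using \<gamma>_cases by auto
  moreover have "Re (cnj \<gamma> * \<gamma>) = (cmod \<gamma>)\<^sup>2"
    by (metis Re_complex_of_real complex_norm_square mult.commute)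
  ultimately show "(bergman_norm (\<lambda>z. f z - (p z + bergman_inner f B * B z)))\<^sup>2
       = (bergman_norm (\<lambda>z. f z - p z))\<^sup>2 - (cmod (bergman_inner f B))\<^sup>2"
    unfolding \<gamma>_def[symmetric] eq bergman_norm_diff_scale[OF bergman_space_diff[OF f ps] Bs] fpB by simp
qed

text \<open>The step \<open>is_projection_Suc\<close> needs projections of both \<open>f\<close> and
  \<open>v n\<close> on the shorter span, hence the induction over arbitrary
  \<open>f\<close>.\<close>

lemma is_projection_proj_preceding:
  assumes "n \<ge> 1" "f \<in> bergman_space"
  shows "is_projection v n f (proj_preceding v n f)"
  using assms
proof (induction n arbitrary: f rule: nat_induct_at_least)
  case base
  have "is_projection v 1 f (\<lambda>z. 0)" by (simp add: is_projection_def)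
  then show ?case
    unfolding proj_preceding_def is_projection_def[symmetric] by (rule someI[where P = "is_projection v 1 f"])
next
  case (Suc n)
  note s = is_projection_Suc(1)[OF Suc.hyps Suc.IH[OF v_in_space[OF Suc.hyps]] Suc.IH[OF Suc.prems] Suc.prems]
  show ?case
    unfolding proj_preceding_def[of v "Suc n"] is_projection_def[symmetric] by (rule someI[where P = "is_projection v (Suc n) f"], rule s)
qed

lemma proj_preceding_in_space:
  "n \<ge> 1 \<Longrightarrow> f \<in> bergman_space \<Longrightarrow> proj_preceding v n f \<in> bergman_space"
  using is_projection_in_space is_projection_proj_preceding by blast

text \<open>Uniqueness identifies the chosen projection with the explicit update on the disc, and
  the norm sees nothing else.\<close>

lemma proj_preceding_Suc:
  assumes n: "n \<ge> 1" and f: "f \<in> bergman_space"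
  shows "z \<in> unit_disc \<Longrightarrow> proj_preceding v (Suc n) f z
      = proj_preceding v n f z + bergman_inner f (gram_schmidt_vec v n) * gram_schmidt_vec v n z"
    and "(bergman_norm (\<lambda>z. f z - proj_preceding v (Suc n) f z))\<^sup>2
      = (bergman_norm (\<lambda>z. f z - proj_preceding v n f z))\<^sup>2 - (cmod (bergman_inner f (gram_schmidt_vec v n)))\<^sup>2"
proof -
  note proj = is_projection_proj_preceding
  note s = is_projection_Suc[OF n proj[OF n v_in_space[OF n]] proj[OF n f] f]
  have B: "gram_schmidt_vec v n = (\<lambda>z. (v n z - proj_preceding v n (v n) z) /
      of_real (bergman_norm (\<lambda>z. v n z - proj_preceding v n (v n) z)))"
    by (simp add: gram_schmidt_vec_def fun_eq_iff)
  have eq: "proj_preceding v (Suc n) f z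
      = proj_preceding v n f z + bergman_inner f (gram_schmidt_vec v n) * gram_schmidt_vec v n z"
    if "z \<in> unit_disc" for z
    using is_projection_unique[OF proj s(1) f that] f unfolding B by simp
  then show "z \<in> unit_disc \<Longrightarrow> proj_preceding v (Suc n) f z
      = proj_preceding v n f z + bergman_inner f (gram_schmidt_vec v n) * gram_schmidt_vec v n z" .
  have "bergman_norm (\<lambda>z. f z - proj_preceding v (Suc n) f z)
      = bergman_norm (\<lambda>z. f z - (proj_preceding v n f z + bergman_inner f (gram_schmidt_vec v n) * gram_schmidt_vec v n z))"
    by (rule bergman_norm_cong) (simp add: eq)
  then show "(bergman_norm (\<lambda>z. f z - proj_preceding v (Suc n) f z))\<^sup>2
      = (bergman_norm (\<lambda>z. f z - proj_preceding v n f z))\<^sup>2 - (cmod (bergman_inner f (gram_schmidt_vec v n)))\<^sup>2"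
    using s(2) unfolding B by simp
qed

lemma proj_preceding_eq_sum:
  assumes f: "f \<in> bergman_space" and z: "z \<in> unit_disc"
  shows "proj_preceding v (Suc n) f z
    = (\<Sum>k=1..n. bergman_inner f (gram_schmidt_vec v k) * gram_schmidt_vec v k z)"
proof (induction n)
  case 0
  then show ?case
    using is_projection_proj_preceding[of 1, OF _ f] by (auto simp: is_projection_def)
next
  case (Suc n)
  then show ?case using proj_preceding_Suc(1)[OF _ f z, of "Suc n"] by simp
qed

lemma norm_residual:
  assumes f: "f \<in> bergman_space"
  shows "(bergman_norm (\<lambda>z. f z - proj_preceding v (Suc n) f z))\<^sup>2
    = (bergman_norm f)\<^sup>2 - (\<Sum>k=1..n. (cmod (bergman_inner f (gram_schmidt_vec v k)))\<^sup>2)"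
proof (induction n)
  case 0
  have "proj_preceding v (Suc 0) f = (\<lambda>z. 0)"
    using is_projection_proj_preceding[of 1, OF _ f] by (auto simp: is_projection_def)
  then show ?case by simp
next
  case (Suc n)
  then show ?case using proj_preceding_Suc(2)[OF _ f, of "Suc n"] by simp
qed

end

section \<open>Derivatives of the kernel\<close>

text \<open>The \<open>m\<close>-th derivative of the kernel with respect to the conjugate variable.\<close>

definition diff_kernel :: "nat \<Rightarrow> complex \<Rightarrow> complex \<Rightarrow> complex" where
  "diff_kernel m w z = fact (Suc m) * z ^ m / (1 - cnj w * z) ^ (m + 2)"

lemma diff_kernel_0: "diff_kernel 0 w = kernel_at w"
  by (simp add: diff_kernel_def bergman_kernel_def fun_eq_iff power2_eq_square)

lemma kernel_denominator_nonzero: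
  assumes "w \<in> unit_disc" "z \<in> unit_disc"
  shows "1 - cnj w * z \<noteq> 0"
  using kernel_denominator[OF assms] assms(1) by auto

text \<open>The variable \<open>u\<close> stands for \<open>cnj w\<close>: the kernel is holomorphic
  in it, so differentiation in the conjugate variable becomes an ordinary complex
  derivative.\<close>

lemma diff_kernel_has_field_derivative:
  assumes "u \<in> unit_disc" "z \<in> unit_disc"
  shows "((\<lambda>u. diff_kernel m (cnj u) z) has_field_derivative diff_kernel (Suc m) (cnj u) z) (at u)"
proof -
  have nz: "1 - u * z \<noteq> 0" using kernel_denominator_nonzero[of "cnj u" z] assms by simp
  define x where "x = 1 - u * z"
  have x: "x \<noteq> 0" using nz by (simp add: x_def)
  have "((\<lambda>u. 1 - u * z) has_field_derivative - z) (at u)"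
    by (auto intro!: derivative_eq_intros)
  from DERIV_cmult[OF DERIV_power[OF DERIV_inverse'[OF this nz], of "m + 2"], of "fact (Suc m) * z ^ m"]
  have "((\<lambda>u. fact (Suc m) * z ^ m * inverse (1 - u * z) ^ (m + 2)) has_field_derivative
     fact (Suc m) * z ^ m * (of_nat (m + 2) * (inverse x * z * inverse x * inverse x ^ (m + 1)))) (at u)"
    by (simp add: x_def)
  also have "fact (Suc m) * z ^ m * (of_nat (m + 2) * (inverse x * z * inverse x * inverse x ^ (m + 1)))
      = (of_nat (m + 2) * fact (Suc m)) * (z ^ m * z) * (inverse x * inverse x * inverse x ^ (m + 1))"
    by (simp only: mult_ac)
  also have "\<dots> = fact (Suc (Suc m)) * z ^ Suc m * inverse x ^ (Suc m + 2)"
    by (simp add: fact_Suc[of "Suc m"] mult_ac del: fact_Suc)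
  finally show ?thesis
    by (simp add: diff_kernel_def divide_inverse power_inverse x_def del: fact_Suc)
qed

lemma diff_kernel_bound:
  assumes "w \<in> cball 0 \<rho>" "\<rho> < 1" "z \<in> unit_disc"
  shows "cmod (diff_kernel m w z) \<le> fact (Suc m) / (1 - \<rho>) ^ (m + 2)"
proof -
  have "1 - \<rho> \<le> cmod (1 - cnj w * z)"
    using kernel_denominator[of w z] assms by auto
  then have "(1 - \<rho>) ^ (m + 2) \<le> cmod (1 - cnj w * z) ^ (m + 2)"
    using assms by (intro power_mono) auto
  moreover have "cmod z ^ m \<le> 1" using assms by (intro power_le_one) auto
  ultimately show ?thesis
    unfolding diff_kernel_def norm_divide norm_mult norm_power norm_fact
    using assms by (intro frac_le) (auto simp del: fact_Suc intro: mult_left_le)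
qed

lemma diff_kernel_in_space:
  assumes w: "w \<in> unit_disc"
  shows "diff_kernel m w \<in> bergman_space"
proof (rule bergman_space_bounded)
  show "diff_kernel m w holomorphic_on unit_disc"
    unfolding diff_kernel_def using kernel_denominator_nonzero[OF w]
    by (intro holomorphic_intros) auto
  show "cmod (diff_kernel m w z) \<le> fact (Suc m) / (1 - cmod w) ^ (m + 2)" if "z \<in> unit_disc" for z
    using diff_kernel_bound[of w "cmod w" z] w that by auto
qed

text \<open>By the chain rule the real derivative of \<open>g\<close> sends \<open>h\<close> to
  \<open>G' * cnj h\<close>, and \<open>(G' + \<i> * (G' * cnj \<i>)) / 2 = G'\<close>. Agreement is
  asked for on an open set because the iterated derivatives of the kernel are identified only on the
  disc.\<close>

lemma wirtinger_bar_cnj: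
  assumes "open S" "w \<in> S" "\<And>x. x \<in> S \<Longrightarrow> g x = G (cnj x)"
    and G: "(G has_field_derivative G') (at (cnj w))"
  shows "wirtinger_bar g w = G'"
proof -
  have "(G has_derivative (\<lambda>h. G' * h)) (at (cnj w))"
    using G by (simp add: has_field_derivative_def)
  moreover have "(cnj has_derivative cnj) (at w)"
    by (intro bounded_linear_imp_has_derivative bounded_linear_cnj)
  ultimately have "((\<lambda>x. G (cnj x)) has_derivative (\<lambda>h. G' * cnj h)) (at w)"
    using has_derivative_compose by blast
  then have "(g has_derivative (\<lambda>h. G' * cnj h)) (at w)"
    using assms(1-3) by (auto intro: has_derivative_transform_within_open)
  then have "frechet_derivative g (at w) = (\<lambda>h. G' * cnj h)"
    using frechet_derivative_at by metis
  then show ?thesis by (simp add: wirtinger_bar_def algebra_simps)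
qed

lemma wirtinger_bar_kernel:
  assumes "w \<in> unit_disc" "z \<in> unit_disc"
  shows "(wirtinger_bar ^^ m) (\<lambda>w. bergman_kernel z w) w = diff_kernel m w z"
  using assms(1)
proof (induction m arbitrary: w)
  case 0
  then show ?case by (simp add: diff_kernel_0)
next
  case (Suc m)
  have "wirtinger_bar ((wirtinger_bar ^^ m) (\<lambda>w. bergman_kernel z w)) w = diff_kernel (Suc m) (cnj (cnj w)) z"
  proof (rule wirtinger_bar_cnj[of unit_disc, where G = "\<lambda>u. diff_kernel m (cnj u) z"])
    show "((\<lambda>u. diff_kernel m (cnj u) z) has_field_derivative diff_kernel (Suc m) (cnj (cnj w)) z) (at (cnj w))"
      using diff_kernel_has_field_derivative[of "cnj w" z m] Suc.prems assms(2) by simp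
  qed (use Suc in auto)
  then show ?case by simp
qed

text \<open>For fixed \<open>z\<close> this is a Taylor expansion in \<open>cnj w\<close>. The
  remainder bound is uniform in \<open>z\<close>, so it is also a bound for the norm; its constant
  is \<open>diff_kernel_bound\<close> at order \<open>m + N + 1\<close>.\<close>

lemma diff_kernel_Taylor:
  assumes b: "b \<in> cball 0 \<rho>" and w: "w \<in> cball 0 \<rho>" and \<rho>: "\<rho> < 1"
  shows "bergman_norm (\<lambda>z. diff_kernel m w z - (\<Sum>i\<le>N. cnj (w - b) ^ i / fact i * diff_kernel (m + i) b z))
    \<le> fact (m + N + 2) / (1 - \<rho>) ^ (m + N + 3) * cmod (w - b) ^ Suc N"
proof (rule bergman_norm_le)
  have wb: "w \<in> unit_disc" "b \<in> unit_disc" using b w \<rho> by auto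
  show "(\<lambda>z. diff_kernel m w z - (\<Sum>i\<le>N. cnj (w - b) ^ i / fact i * diff_kernel (m + i) b z)) holomorphic_on unit_disc"
    by (intro holomorphic_intros bergman_space_holomorphic diff_kernel_in_space wb)
  fix z :: complex assume z: "z \<in> unit_disc"
  let ?B = "fact (m + N + 2) / (1 - \<rho>) ^ (m + N + 3)"
  have "cmod (diff_kernel (m + 0) (cnj (cnj w)) z
      - (\<Sum>i\<le>N. diff_kernel (m + i) (cnj (cnj b)) z * (cnj w - cnj b) ^ i / fact i))
    \<le> ?B * cmod (cnj w - cnj b) ^ Suc N / fact N"
  proof (rule complex_Taylor[where S = "cball 0 \<rho>" and f = "\<lambda>i u. diff_kernel (m + i) (cnj u) z"])
    fix i u assume "u \<in> cball (0::complex) \<rho>"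
    then show "((\<lambda>u. diff_kernel (m + i) (cnj u) z) has_field_derivative diff_kernel (m + Suc i) (cnj u) z)
        (at u within cball 0 \<rho>)"
      using diff_kernel_has_field_derivative[of u z "m + i"] z \<rho>
      by (auto intro: has_field_derivative_at_within)
  next
    fix u assume "u \<in> cball (0::complex) \<rho>"
    then show "cmod (diff_kernel (m + Suc N) (cnj u) z) \<le> ?B"
      using diff_kernel_bound[of "cnj u" \<rho> z "m + Suc N"] z \<rho>
      by (simp add: numeral_eq_Suc del: fact_Suc power_Suc)
  qed (use b w in auto)
  \<comment> \<open>The factor \<open>1 / fact N\<close> in the remainder is discarded.\<close>
  also have "\<dots> \<le> ?B * cmod (cnj w - cnj b) ^ Suc N"
    using \<rho> divide_left_mono[of 1 "fact N" "?B * cmod (cnj w - cnj b) ^ Suc N"]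
    by (simp add: fact_ge_1 del: fact_Suc power_Suc)
  finally show "cmod (diff_kernel m w z - (\<Sum>i\<le>N. cnj (w - b) ^ i / fact i * diff_kernel (m + i) b z))
    \<le> ?B * cmod (w - b) ^ Suc N"
    by (simp add: mult.commute flip: complex_cnj_diff)
qed

text \<open>By induction the pairing \<open>I x\<close> is the \<open>m\<close>-th derivative of
  \<open>f\<close> at \<open>x\<close>. The pairing is conjugate linear on the right, which turns
  \<open>cnj (x - w)\<close> into \<open>x - w\<close>; the Taylor estimate with
  \<open>N = 1\<close> therefore shows that \<open>I\<close> is complex differentiable and
  identifies its derivative.\<close>

lemma diff_kernel_reproducing:
  assumes f: "f \<in> bergman_space" and w: "w \<in> unit_disc"
  shows "bergman_inner f (diff_kernel m w) = (deriv ^^ m) f w"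
  using w
proof (induction m arbitrary: w)
  case 0
  then show ?case by (simp add: diff_kernel_0 bergman_reproducing[OF f])
next
  case (Suc m)
  note b = Suc.prems
  obtain \<rho> where \<rho>: "cmod w < \<rho>" "\<rho> < 1" using b dense by auto
  define C where "C = bergman_norm f * (fact (m + 1 + 2) / (1 - \<rho>) ^ (m + 1 + 3))"
  define I where "I = (\<lambda>x. bergman_inner f (diff_kernel m x))"
  have est: "cmod (I x - I w - (x - w) * bergman_inner f (diff_kernel (Suc m) w)) \<le> C * cmod (x - w) ^ 2"
    if x: "x \<in> ball 0 \<rho>" for x
  proof -
    have xD: "x \<in> unit_disc" using x \<rho> by auto
    let ?T = "\<lambda>z. diff_kernel m x z - (\<Sum>i\<le>1. cnj (x - w) ^ i / fact i * diff_kernel (m + i) w z)"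
    have sum: "(\<lambda>z. \<Sum>i\<le>1. cnj (x - w) ^ i / fact i * diff_kernel (m + i) w z)
        = (\<lambda>z. diff_kernel m w z + cnj (x - w) * diff_kernel (Suc m) w z)"
      by simp
    note dk = diff_kernel_in_space[OF xD] diff_kernel_in_space[OF b]
    have T: "?T \<in> bergman_space"
      by (intro bergman_space_intros diff_kernel_in_space xD b)
    have "bergman_inner f ?T = I x - I w - (x - w) * bergman_inner f (diff_kernel (Suc m) w)"
      unfolding sum I_def
      by (simp add: bergman_inner_diff_right bergman_inner_add_right bergman_inner_scale_right
          bergman_space_add bergman_space_scale dk f del: complex_cnj_diff)
    then show ?thesis
      using bergman_Cauchy_Schwarz[OF f T] mult_left_mono[OF diff_kernel_Taylor[of w \<rho> x m 1], of "bergman_norm f"] x \<rho>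
      by (simp add: C_def numeral_2_eq_2 mult.assoc del: fact_Suc)
  qed
  have "((\<lambda>x. (I x - I w) / (x - w) - bergman_inner f (diff_kernel (Suc m) w)) \<longlongrightarrow> 0) (at w)"
  proof (rule Lim_null_comparison)
    have "eventually (\<lambda>x. x \<in> ball 0 \<rho> \<and> x \<noteq> w) (at w)"
      using \<rho> by (intro eventually_conj eventually_at_in_open') (auto simp: eventually_at_filter)
    then show "\<forall>\<^sub>F x in at w. norm ((I x - I w) / (x - w) - bergman_inner f (diff_kernel (Suc m) w)) \<le> C * cmod (x - w)"
    proof eventually_elim
      case (elim x)
      have "(I x - I w) / (x - w) - bergman_inner f (diff_kernel (Suc m) w)
          = (I x - I w - (x - w) * bergman_inner f (diff_kernel (Suc m) w)) / (x - w)"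
        using elim by (simp add: diff_divide_distrib)
      then have "norm ((I x - I w) / (x - w) - bergman_inner f (diff_kernel (Suc m) w)) * cmod (x - w)
          \<le> C * cmod (x - w) * cmod (x - w)"
        using est[of x] elim by (simp add: norm_divide power2_eq_square mult.assoc)
      then show ?case using elim by (auto simp: mult_le_cancel_right)
    qed
    have "((\<lambda>x. C * cmod (x - w)) \<longlongrightarrow> C * cmod (w - w)) (at w)" by (intro tendsto_intros)
    then show "((\<lambda>x. C * cmod (x - w)) \<longlongrightarrow> 0) (at w)" by simp
  qed
  then have "(I has_field_derivative bergman_inner f (diff_kernel (Suc m) w)) (at w)"
    unfolding has_field_derivative_iff using Lim_null by blast
  then have "((deriv ^^ m) f has_field_derivative bergman_inner f (diff_kernel (Suc m) w)) (at w)"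
    using b Suc.IH unfolding I_def
    by (auto intro: has_field_derivative_transform_within_open[of _ _ _ unit_disc])
  then show ?case by (simp add: DERIV_imp_deriv)
qed

section \<open>Zero-based subspaces\<close>

lemma bergman_tendsto_pointwise:
  assumes "bergman_tendsto f g F" "z \<in> unit_disc"
  shows "((\<lambda>w. f w z) \<longlongrightarrow> g z) F"
proof -
  have "((\<lambda>w. f w z - g z) \<longlongrightarrow> 0) F"
  proof (rule Lim_null_comparison)
    have ev: "\<forall>\<^sub>F w in F. f w \<in> bergman_space" and g: "g \<in> bergman_space"
      using assms(1) by (auto simp: bergman_tendsto_def)
    from ev show "\<forall>\<^sub>F w in F. norm (f w z - g z)
        \<le> bergman_norm (\<lambda>z. f w z - g z) * bergman_norm (kernel_at z)"
      by eventually_elim (rule bergman_point_evaluation[OF bergman_space_diff[OF _ g] assms(2)])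
    show "((\<lambda>w. bergman_norm (\<lambda>z. f w z - g z) * bergman_norm (kernel_at z)) \<longlongrightarrow> 0) F"
      using assms(1) by (intro tendsto_mult_left_zero) (simp add: bergman_tendsto_def)
  qed
  then show ?thesis using Lim_null by blast
qed

lemma bergman_tendsto_restrict:
  assumes f: "bergman_tendsto f g F" and "F' \<le> F" and ev: "\<forall>\<^sub>F w in F'. f w = f' w"
  shows "bergman_tendsto f' g F'"
proof -
  have "\<forall>\<^sub>F w in F'. f w \<in> bergman_space"
    using f \<open>F' \<le> F\<close> by (auto simp: bergman_tendsto_def le_filter_def)
  with ev have "\<forall>\<^sub>F w in F'. f' w \<in> bergman_space" by eventually_elim simp
  moreover have "((\<lambda>w. bergman_norm (\<lambda>z. f w z - g z)) \<longlongrightarrow> 0) F'"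
    using f \<open>F' \<le> F\<close> by (auto simp: bergman_tendsto_def intro: tendsto_mono)
  then have "((\<lambda>w. bergman_norm (\<lambda>z. f' w z - g z)) \<longlongrightarrow> 0) F'"
    by (rule Lim_transform_eventually) (use ev in \<open>auto elim: eventually_mono\<close>)
  ultimately show ?thesis using f by (simp add: bergman_tendsto_def)
qed

text \<open>The difference of the unit vectors is \<open>(u - y)\<close> over the norm of
  \<open>y\<close>, plus \<open>u\<close> times a difference of reciprocal norms. Each part costs at
  most the distance of \<open>u\<close> and \<open>y\<close> over the norm of \<open>y\<close>,
  hence the 2. If \<open>u\<close> has norm 0, the second part has norm 0 as well.\<close>

lemma bergman_normalize_diff:
  assumes u: "u \<in> bergman_space" and y: "y \<in> bergman_space" and ny: "bergman_norm y > 0"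
  shows "bergman_norm (\<lambda>z. u z / of_real (bergman_norm u) - y z / of_real (bergman_norm y))
    \<le> 2 * bergman_norm (\<lambda>z. u z - y z) / bergman_norm y"
proof -
  let ?d = "bergman_norm (\<lambda>z. u z - y z)"
  define k :: real where "k = 1 / bergman_norm u - 1 / bergman_norm y"
  have abs: "\<bar>bergman_norm u - bergman_norm y\<bar> \<le> ?d" by (rule bergman_norm_triangle_abs[OF u y])
  have eq: "(\<lambda>z. u z / of_real (bergman_norm u) - y z / of_real (bergman_norm y))
      = (\<lambda>z. (u z - y z) / of_real (bergman_norm y) + of_real k * u z)"
    by (auto simp: k_def algebra_simps diff_divide_distrib)
  have "bergman_norm (\<lambda>z. u z / of_real (bergman_norm u) - y z / of_real (bergman_norm y))
      \<le> bergman_norm (\<lambda>z. (u z - y z) / of_real (bergman_norm y)) + bergman_norm (\<lambda>z. of_real k * u z)"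
    unfolding eq by (intro bergman_norm_triangle bergman_space_intros u y)
  also have "\<dots> = ?d / bergman_norm y + \<bar>k\<bar> * bergman_norm u"
    using ny by (simp add: bergman_norm_divide bergman_norm_scale)
  also have "\<bar>k\<bar> * bergman_norm u \<le> ?d / bergman_norm y"
  proof (cases "bergman_norm u = 0")
    case False
    then have "k * bergman_norm u = (bergman_norm y - bergman_norm u) / bergman_norm y"
      using ny by (simp add: k_def field_simps)
    then have "\<bar>k\<bar> * bergman_norm u = \<bar>bergman_norm y - bergman_norm u\<bar> / bergman_norm y"
      using ny by (metis abs_mult abs_divide abs_of_nonneg abs_of_pos bergman_norm_nonneg)
    also have "\<dots> \<le> ?d / bergman_norm y"
      using abs ny by (intro divide_right_mono) auto
    finally show ?thesis .
  qed (use ny in simp)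
  finally show ?thesis by simp
qed

text \<open>The difference \<open>?g\<close> lies in \<open>H\<close>, and both kernels evaluate it
  at \<open>w\<close>; so \<open>?g\<close> is orthogonal to itself.\<close>

lemma reproducing_kernel_unique:
  assumes K: "reproducing_kernel H K" and L: "reproducing_kernel H L"
    and H: "H \<subseteq> bergman_space" "\<And>f g. f \<in> H \<Longrightarrow> g \<in> H \<Longrightarrow> (\<lambda>z. f z - g z) \<in> H"
    and wz: "w \<in> unit_disc" "z \<in> unit_disc"
  shows "K z w = L z w"
proof -
  let ?g = "\<lambda>z. K z w - L z w"
  have KL: "(\<lambda>z. K z w) \<in> H" "(\<lambda>z. L z w) \<in> H"
    using K L wz by (auto simp: reproducing_kernel_def)
  have g: "?g \<in> H" using H(2)[OF KL] .
  have "bergman_inner ?g (\<lambda>z. K z w) = bergman_inner ?g (\<lambda>z. L z w)"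
    using K L g wz unfolding reproducing_kernel_def by metis
  then have "bergman_inner ?g ?g = 0"
    using KL g H(1) by (subst bergman_inner_diff_right) auto
  then have "bergman_norm ?g = 0" by (simp add: bergman_inner_self)
  then show ?thesis using bergman_norm_eq_0_imp[of ?g z] g H(1) wz by auto
qed

lemma zero_based_subspace_Nil: "zero_based_subspace [] = bergman_space"
  by (simp add: zero_based_subspace_def)

lemma reproducing_kernel_bergman: "reproducing_kernel bergman_space bergman_kernel"
  by (simp add: reproducing_kernel_def bergman_kernel_in_space bergman_reproducing)

section \<open>Multiplicities in the tuple and orders of vanishing\<close>

lemma initial_tuple_0: "initial_tuple a 0 = []"
  by (simp add: initial_tuple_def)

lemma initial_tuple_Suc: "initial_tuple a (Suc n) = initial_tuple a n @ [a (Suc n)]"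
  by (simp add: initial_tuple_def)

lemma set_initial_tuple: "set (initial_tuple a n) = a ` {1..n}"
  by (auto simp: initial_tuple_def)

lemma occurrence_Suc: "occurrence a (Suc n) = Suc (count_list (initial_tuple a n) (a (Suc n)))"
  by (simp add: occurrence_def initial_tuple_Suc)

text \<open>If \<open>c\<close> occurs \<open>l\<close> times, its occurrences are numbered
  \<open>1, ..., l\<close>, so the orders \<open>occurrence a i - 1\<close> at these indices run
  through \<open>0, ..., l - 1\<close>. Appending a point adds exactly the next order at that
  point.\<close>

lemma all_multiplicity_iff_all_occurrence:
  "(\<forall>c\<in>set (initial_tuple a n). \<forall>j<count_list (initial_tuple a n) c. P c j)
    \<longleftrightarrow> (\<forall>i\<in>{1..n}. P (a i) (occurrence a i - 1))"
proof -
  \<comment> \<open>The induction lets \<open>c\<close> range over all points; outside the tuple the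
    count is 0 and the condition empty.\<close>
  have "(\<forall>c. \<forall>j<count_list (initial_tuple a n) c. P c j)
    \<longleftrightarrow> (\<forall>i\<in>{1..n}. P (a i) (occurrence a i - 1))"
  proof (induction n)
    case (Suc n)
    have "(\<forall>c. \<forall>j<count_list (initial_tuple a (Suc n)) c. P c j) \<longleftrightarrow>
        P (a (Suc n)) (count_list (initial_tuple a n) (a (Suc n))) \<and>
        (\<forall>c. \<forall>j<count_list (initial_tuple a n) c. P c j)"
      by (auto simp: initial_tuple_Suc less_Suc_eq)
    then show ?case
      unfolding Suc.IH by (simp add: atLeastAtMostSuc_conv occurrence_Suc)
  qed (simp add: initial_tuple_0)
  moreover have "count_list (initial_tuple a n) c = 0" if "c \<notin> set (initial_tuple a n)" for c
    using that by (simp add: count_list_0_iff)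
  ultimately show ?thesis by (metis not_less_zero)
qed

text \<open>In the Leibniz expansion at \<open>c\<close> a term survives only if all
  \<open>m\<close> derivatives fall on the power.\<close>

lemma higher_deriv_power_mult:
  fixes c :: complex
  assumes q: "q holomorphic_on UNIV" and j: "j \<le> m"
  shows "(deriv ^^ j) (\<lambda>z. (z - c) ^ m * q z) c = (if j = m then fact m * q c else 0)"
proof -
  have pow: "(deriv ^^ i) (\<lambda>z. (z - c) ^ m) c = (if i = m then fact m else 0)" if "i \<le> m" for i
    using that by (auto simp: higher_deriv_power pochhammer_fact)
  have "(deriv ^^ j) (\<lambda>z. (z - c) ^ m * q z) c
      = (\<Sum>i = 0..j. of_nat (j choose i) * (deriv ^^ i) (\<lambda>z. (z - c) ^ m) c * (deriv ^^ (j - i)) q c)"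
    using q by (intro higher_deriv_mult[where S = UNIV]) (auto intro!: holomorphic_intros)
  also have "\<dots> = (\<Sum>i = 0..j. if i = m then fact m * q c else 0)"
    using j by (intro sum.cong) (auto simp: pow)
  also have "\<dots> = (if j = m then fact m * q c else 0)" using j by auto
  finally show ?thesis .
qed

text \<open>The exponent is the exact order of the zero, possibly 0. It gives both the vanishing
  that puts the product into the zero-based subspace and the nonzero derivative of the next
  order.\<close>

lemma prod_linear_factorization:
  fixes a :: "nat \<Rightarrow> complex"
  shows "\<exists>q. q holomorphic_on UNIV \<and> q c \<noteq> 0 \<and>
    (\<lambda>z. \<Prod>i=1..n. z - a i) = (\<lambda>z. (z - c) ^ count_list (initial_tuple a n) c * q z)"
proof (induction n)
  case 0
  then show ?case by (intro exI[of _ "\<lambda>_. 1"]) (simp add: initial_tuple_0)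
next
  case (Suc n)
  then obtain q where q: "q holomorphic_on UNIV" "q c \<noteq> 0"
    "(\<lambda>z. \<Prod>i=1..n. z - a i) = (\<lambda>z. (z - c) ^ count_list (initial_tuple a n) c * q z)" by blast
  show ?case
  proof (cases "a (Suc n) = c")
    case True
    then show ?thesis
      using q by (intro exI[of _ q]) (auto simp: fun_eq_iff initial_tuple_Suc)
  next
    case False
    then show ?thesis
      using q by (intro exI[of _ "\<lambda>z. q z * (z - a (Suc n))"])
        (auto simp: fun_eq_iff initial_tuple_Suc intro!: holomorphic_intros)
  qed
qed

section \<open>The zero-based subspace as an orthogonal complement\<close>

locale disc_sequence =
  fixes a :: "nat \<Rightarrow> complex"
  assumes a_in_disc: "\<And>i. i \<ge> 1 \<Longrightarrow> a i \<in> unit_disc"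
begin

lemma gen_kernel_eq:
  "i \<ge> 1 \<Longrightarrow> z \<in> unit_disc \<Longrightarrow> gen_kernel a i z = diff_kernel (occurrence a i - 1) (a i) z"
  unfolding gen_kernel_def by (rule wirtinger_bar_kernel[OF a_in_disc])

lemma gen_kernel_in_space: "i \<ge> 1 \<Longrightarrow> gen_kernel a i \<in> bergman_space"
  by (rule bergman_space_cong[OF diff_kernel_in_space[OF a_in_disc]]) (simp_all add: gen_kernel_eq)

sublocale bergman_sequence "gen_kernel a"
  by unfold_locales (rule gen_kernel_in_space)

lemma gen_kernel_reproducing:
  assumes "f \<in> bergman_space" "i \<ge> 1"
  shows "bergman_inner f (gen_kernel a i) = (deriv ^^ (occurrence a i - 1)) f (a i)"
  using diff_kernel_reproducing[OF assms(1) a_in_disc[OF assms(2)]] assms(2)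
  by (subst bergman_inner_cong[of f f _ "diff_kernel (occurrence a i - 1) (a i)"]) (auto simp: gen_kernel_eq)

lemma mem_zero_based_iff:
  "f \<in> zero_based_subspace (initial_tuple a n) \<longleftrightarrow>
    f \<in> bergman_space \<and> (\<forall>i\<in>{1..n}. bergman_inner f (gen_kernel a i) = 0)"
  unfolding zero_based_subspace_def
  using all_multiplicity_iff_all_occurrence[of a n "\<lambda>c j. (deriv ^^ j) f c = 0"]
  by (auto simp: gen_kernel_reproducing)

lemma zero_based_diff_scale:
  assumes "f \<in> zero_based_subspace (initial_tuple a n)" "g \<in> zero_based_subspace (initial_tuple a n)"
  shows "(\<lambda>z. f z - c * g z) \<in> zero_based_subspace (initial_tuple a n)"
  using assms by (simp add: mem_zero_based_iff bergman_space_diff bergman_space_scale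
      bergman_inner_diff_left bergman_inner_scale_left gen_kernel_in_space)

lemma zero_based_diff:
  assumes "f \<in> zero_based_subspace (initial_tuple a n)" "g \<in> zero_based_subspace (initial_tuple a n)"
  shows "(\<lambda>z. f z - g z) \<in> zero_based_subspace (initial_tuple a n)"
  using zero_based_diff_scale[OF assms, of 1] by simp

text \<open>The index is \<open>Suc n\<close> because \<open>proj_preceding v k\<close> projects on
  \<open>v 1, ..., v (k - 1)\<close>; so exactly the first \<open>n\<close> generalized kernels are
  removed.\<close>

definition residual :: "nat \<Rightarrow> (complex \<Rightarrow> complex) \<Rightarrow> complex \<Rightarrow> complex" where
  "residual n f z = f z - proj_preceding (gen_kernel a) (Suc n) f z"

lemma residual_in_space: "f \<in> bergman_space \<Longrightarrow> residual n f \<in> bergman_space"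
  unfolding residual_def by (intro bergman_space_diff proj_preceding_in_space) auto

lemma residual_in_zero_based:
  assumes "f \<in> bergman_space"
  shows "residual n f \<in> zero_based_subspace (initial_tuple a n)"
  using is_projection_proj_preceding[OF _ assms, of "Suc n"] residual_in_space[OF assms]
  by (auto simp: mem_zero_based_iff is_projection_def residual_def[abs_def])

lemma inner_residual:
  assumes h: "h \<in> zero_based_subspace (initial_tuple a n)" and f: "f \<in> bergman_space"
  shows "bergman_inner h (residual n f) = bergman_inner h f"
proof -
  have h0: "bergman_inner h (gen_kernel a i) = 0" if "i \<in> {1..<Suc n}" for i
    using h that by (auto simp: mem_zero_based_iff)
  have hs: "h \<in> bergman_space" using h by (simp add: mem_zero_based_iff)
  obtain c where c: "proj_preceding (gen_kernel a) (Suc n) f = (\<lambda>z. \<Sum>j\<in>{1..<Suc n}. c j * gen_kernel a j z)"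
    using is_projection_proj_preceding[OF _ f, of "Suc n"] by (auto simp: is_projection_def)
  have "bergman_inner h (proj_preceding (gen_kernel a) (Suc n) f)
      = (\<Sum>j\<in>{1..<Suc n}. bergman_inner h (\<lambda>z. c j * gen_kernel a j z))"
    unfolding c by (intro bergman_inner_sum_right bergman_space_scale gen_kernel_in_space hs) auto
  also have "\<dots> = 0"
    using h0 by (intro sum.neutral) (simp add: bergman_inner_scale_right)
  finally show ?thesis
    unfolding residual_def using bergman_inner_diff_right[OF f proj_preceding_in_space[OF _ f] hs, of "Suc n"] by simp
qed

lemma reproducing_kernel_residual:
  "reproducing_kernel (zero_based_subspace (initial_tuple a n)) (\<lambda>z w. residual n (kernel_at w) z)"
  unfolding reproducing_kernel_def
proof (intro ballI conjI)
  fix w assume w: "w \<in> unit_disc"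
  show "(\<lambda>z. residual n (kernel_at w) z) \<in> zero_based_subspace (initial_tuple a n)"
    by (rule residual_in_zero_based[OF bergman_kernel_in_space[OF w]])
  fix f assume f: "f \<in> zero_based_subspace (initial_tuple a n)"
  then show "f w = bergman_inner f (\<lambda>z. residual n (kernel_at w) z)"
    using inner_residual[OF f bergman_kernel_in_space[OF w]] bergman_reproducing[OF _ w, of f]
    by (simp add: mem_zero_based_iff)
qed

text \<open>Changing the entry at \<open>Suc n\<close> does not affect the predicate that
  \<open>proj_preceding\<close> chooses from, so the chosen functions are equal everywhere and not
  just on the disc.\<close>

lemma ext_basis_vec_eq:
  "ext_basis_vec a n w = (\<lambda>z. residual n (kernel_at w) z / of_real (bergman_norm (residual n (kernel_at w))))"
proof -
  have "(\<Sum>j\<in>{1..<Suc n}. c j * ((gen_kernel a)(Suc n := k)) j z)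
      = (\<Sum>j\<in>{1..<Suc n}. c j * gen_kernel a j z)" for c k z
    by (rule sum.cong) auto
  moreover have "(\<forall>j\<in>{1..<Suc n}. bergman_inner g (((gen_kernel a)(Suc n := k)) j) = 0)
      \<longleftrightarrow> (\<forall>j\<in>{1..<Suc n}. bergman_inner g (gen_kernel a j) = 0)" for g k
    by auto
  ultimately have "proj_preceding ((gen_kernel a)(Suc n := k)) (Suc n) f = proj_preceding (gen_kernel a) (Suc n) f" for k f
    unfolding proj_preceding_def by (simp only:)
  then show ?thesis
    by (simp add: ext_basis_vec_def gram_schmidt_vec_def residual_def[abs_def] fun_eq_iff)
qed

lemma basis_vec_Suc_eq:
  "basis_vec a (Suc n) = (\<lambda>z. residual n (gen_kernel a (Suc n)) z
     / of_real (bergman_norm (residual n (gen_kernel a (Suc n)))))"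
  by (simp add: basis_vec_def gram_schmidt_vec_def residual_def[abs_def] fun_eq_iff)

lemma norm_residual_eq:
  assumes "f \<in> bergman_space"
  shows "bergman_norm (residual n f)
    = sqrt ((bergman_norm f)\<^sup>2 - (\<Sum>k=1..n. (cmod (bergman_inner f (basis_vec a k)))\<^sup>2))"
  using norm_residual[OF assms, of n]
  by (intro real_sqrt_unique[symmetric]) (simp_all add: basis_vec_def residual_def[abs_def])

lemma kernel_residual_eq:
  "z \<in> unit_disc \<Longrightarrow> kernel_residual a n z = residual n (gen_kernel a (Suc n)) z"
  using proj_preceding_eq_sum[OF gen_kernel_in_space[of "Suc n"]]
  by (simp add: kernel_residual_def residual_def basis_vec_def)

lemma prod_linear_in_zero_based:
  "(\<lambda>z. \<Prod>i=1..n. z - a i) \<in> zero_based_subspace (initial_tuple a n)"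
proof -
  have "(\<lambda>z. \<Prod>i=1..n. z - a i) \<in> bergman_space"
  proof (rule bergman_space_bounded)
    show "(\<lambda>z. \<Prod>i=1..n. z - a i) holomorphic_on unit_disc" by (intro holomorphic_intros)
    show "cmod (\<Prod>i=1..n. z - a i) \<le> (\<Prod>i=1..n. 2)" if z: "z \<in> unit_disc" for z
      unfolding prod_norm[symmetric]
    proof (rule prod_mono, intro conjI)
      fix i assume "i \<in> {1..n}"
      then show "cmod (z - a i) \<le> 2"
        using norm_triangle_ineq4[of z "a i"] a_in_disc[of i] z by auto
    qed simp
  qed
  moreover have "(deriv ^^ j) (\<lambda>z. \<Prod>i=1..n. z - a i) c = 0" if "j < count_list (initial_tuple a n) c" for c j
    using prod_linear_factorization[of c a n] higher_deriv_power_mult[of _ j _ c] that by auto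
  ultimately show ?thesis by (simp add: zero_based_subspace_def)
qed

text \<open>Pairing the product of linear factors with this residual evaluates a derivative of the
  product at \<open>a (Suc n)\<close> that is not 0, whereas norm 0 would force the pairing to
  vanish by Cauchy-Schwarz.\<close>

lemma norm_residual_gen_kernel_pos: "bergman_norm (residual n (gen_kernel a (Suc n))) > 0"
proof (rule ccontr)
  define b where "b = a (Suc n)"
  define p where "p = (\<lambda>z. \<Prod>i=1..n. z - a i)"
  have p: "p \<in> zero_based_subspace (initial_tuple a n)"
    unfolding p_def by (rule prod_linear_in_zero_based)
  then have ps: "p \<in> bergman_space" by (simp add: mem_zero_based_iff)
  assume "\<not> ?thesis"
  then have "bergman_norm (residual n (gen_kernel a (Suc n))) = 0"
    using bergman_norm_nonneg[of "residual n (gen_kernel a (Suc n))"] by linarith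
  then have "bergman_inner p (residual n (gen_kernel a (Suc n))) = 0"
    using bergman_Cauchy_Schwarz[OF ps residual_in_space[OF gen_kernel_in_space, of "Suc n" n]] by simp
  then have "bergman_inner p (gen_kernel a (Suc n)) = 0"
    by (simp add: inner_residual[OF p] gen_kernel_in_space)
  then have "(deriv ^^ (count_list (initial_tuple a n) b)) p b = 0"
    by (simp add: gen_kernel_reproducing[OF ps] occurrence_Suc b_def)
  moreover obtain q where "q holomorphic_on UNIV" "q b \<noteq> 0"
      "p = (\<lambda>z. (z - b) ^ count_list (initial_tuple a n) b * q z)"
    using prod_linear_factorization[of b a n] unfolding p_def by blast
  ultimately show False using higher_deriv_power_mult[of q _ _ b] by auto
qed

text \<open>
  The difference \<open>h\<close> of the two residuals lies in the zero-based subspace, so it is orthogonal to the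
  derivatives of the kernel at \<open>a (Suc n)\<close> of order less than \<open>m\<close>. Pairing \<open>h\<close> with itself therefore
  leaves only the remainder of the Taylor expansion of the kernel.
\<close>

lemma residual_kernel_asymptotics:
  fixes n
  defines "b \<equiv> a (Suc n)" and "m \<equiv> occurrence a (Suc n) - 1"
  assumes \<rho>: "b \<in> cball 0 \<rho>" "w \<in> cball 0 \<rho>" "\<rho> < 1"
  shows "bergman_norm (\<lambda>z. residual n (kernel_at w) z
      - cnj (w - b) ^ m / fact m * residual n (gen_kernel a (Suc n)) z)
    \<le> fact (m + 2) / (1 - \<rho>) ^ (m + 3) * cmod (w - b) ^ Suc m"
proof -
  let ?V = "gen_kernel a (Suc n)"
  define \<gamma> where "\<gamma> i = cnj (w - b) ^ i / fact i" for i
  define h where "h = (\<lambda>z. residual n (kernel_at w) z - \<gamma> m * residual n ?V z)"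
  define E where "E = (\<lambda>z. diff_kernel 0 w z - (\<Sum>i\<le>m. \<gamma> i * diff_kernel (0 + i) b z))"
  have wD: "w \<in> unit_disc" and bD: "b \<in> unit_disc" using \<rho> by auto
  note ks = bergman_kernel_in_space[OF wD] and Vs = gen_kernel_in_space[of "Suc n"]
  note dk = diff_kernel_in_space[OF bD]
  have h: "h \<in> zero_based_subspace (initial_tuple a n)"
    unfolding h_def by (intro zero_based_diff_scale residual_in_zero_based ks Vs) simp
  then have hs: "h \<in> bergman_space" by (simp add: mem_zero_based_iff)
  have Es: "E \<in> bergman_space"
    unfolding E_def by (intro bergman_space_diff bergman_space_sum bergman_space_scale diff_kernel_in_space wD bD)
  have m: "m = count_list (initial_tuple a n) b" by (simp add: m_def b_def occurrence_Suc)
  have low: "bergman_inner h (diff_kernel i b) = 0" if "i < m" for i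
  proof -
    have "b \<in> set (initial_tuple a n)" using that unfolding m by (metis count_notin less_nat_zero_code)
    then have "(deriv ^^ i) h b = 0" using h that unfolding m zero_based_subspace_def by blast
    then show ?thesis using diff_kernel_reproducing[OF hs bD] by simp
  qed
  have top: "bergman_inner h (diff_kernel m b) = bergman_inner h ?V"
    by (rule bergman_inner_cong) (simp_all add: gen_kernel_eq m_def b_def)
  have "bergman_inner h (\<lambda>z. \<Sum>i\<le>m. \<gamma> i * diff_kernel i b z)
      = (\<Sum>i\<le>m. cnj (\<gamma> i) * bergman_inner h (diff_kernel i b))"
    by (subst bergman_inner_sum_right) (simp_all add: bergman_space_scale dk hs bergman_inner_scale_right)
  also have "\<dots> = (\<Sum>i\<le>m. if i = m then cnj (\<gamma> m) * bergman_inner h ?V else 0)"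
    using low top by (intro sum.cong) auto
  finally have sum: "bergman_inner h (\<lambda>z. \<Sum>i\<le>m. \<gamma> i * diff_kernel i b z) = cnj (\<gamma> m) * bergman_inner h ?V"
    by simp
  have "bergman_inner h h = bergman_inner h (residual n (kernel_at w)) - cnj (\<gamma> m) * bergman_inner h (residual n ?V)"
    by (subst (2) h_def, subst bergman_inner_diff_right)
       (simp_all add: residual_in_space ks Vs bergman_space_scale hs bergman_inner_scale_right)
  also have "\<dots> = bergman_inner h (kernel_at w) - cnj (\<gamma> m) * bergman_inner h ?V"
    by (simp add: inner_residual[OF h] ks Vs)
  also have "\<dots> = bergman_inner h E"
    unfolding E_def add_0 diff_kernel_0
    by (subst bergman_inner_diff_right)
       (simp_all add: ks hs sum bergman_space_sum bergman_space_scale dk)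
  finally have "cmod (bergman_inner h h) \<le> bergman_norm h * bergman_norm E"
    using bergman_Cauchy_Schwarz[OF hs Es] by simp
  then have "(bergman_norm h)\<^sup>2 \<le> bergman_norm h * bergman_norm E"
    unfolding bergman_inner_self norm_of_real by simp
  then have "bergman_norm h \<le> bergman_norm E"
    using bergman_norm_nonneg[of h]
    by (cases "bergman_norm h = 0") (auto simp: power2_eq_square mult_le_cancel_left)
  also have "\<dots> \<le> fact (0 + m + 2) / (1 - \<rho>) ^ (0 + m + 3) * cmod (w - b) ^ Suc m"
    unfolding E_def \<gamma>_def by (rule diff_kernel_Taylor[OF \<rho>])
  finally show ?thesis by (simp add: h_def \<gamma>_def)
qed

text \<open>After multiplication by the phase, the residual of the kernel is a positive multiple
  \<open>t * V\<close> of a fixed vector, up to an error of size \<open>t * cmod (w - b)\<close>.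
  Normalization removes \<open>t\<close>, and the distance to the limit is at most linear in
  \<open>cmod (w - b)\<close>.\<close>

theorem ext_basis_vec_tendsto:
  "bergman_tendsto (\<lambda>w z. approach_phase a n w * ext_basis_vec a n w z)
     (\<lambda>z. kernel_residual a n z / of_real (bergman_norm (kernel_residual a n))) (at (a (Suc n)))"
proof -
  define b where "b = a (Suc n)"
  define m where "m = occurrence a (Suc n) - 1"
  define V where "V = residual n (gen_kernel a (Suc n))"
  define R where "R = (\<lambda>z. kernel_residual a n z / of_real (bergman_norm (kernel_residual a n)))"
  have V_pos: "bergman_norm V > 0" unfolding V_def by (rule norm_residual_gen_kernel_pos)
  have Vs: "V \<in> bergman_space" unfolding V_def by (intro residual_in_space gen_kernel_in_space) simp
  have R_eq: "R z = V z / of_real (bergman_norm V)" if "z \<in> unit_disc" for z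
    using that kernel_residual_eq[of _ n] bergman_norm_cong[of "kernel_residual a n" V]
    by (simp add: R_def V_def)
  have Rs: "R \<in> bergman_space"
    by (rule bergman_space_cong[OF bergman_space_divide[OF Vs, of "of_real (bergman_norm V)"]]) (simp add: R_eq)
  have bD: "b \<in> unit_disc" unfolding b_def by (rule a_in_disc) simp
  then obtain \<rho> where \<rho>: "cmod b < \<rho>" "\<rho> < 1" using dense by auto
  have near: "\<forall>\<^sub>F w in at b. w \<in> ball 0 \<rho> \<and> w \<noteq> b"
    using \<rho> by (intro eventually_conj eventually_at_in_open') (auto simp: eventually_at_filter)
  \<comment> \<open>The Taylor constant, doubled by \<open>bergman_normalize_diff\<close> and
    divided by the norm of \<open>t * V\<close>; the power of \<open>cmod (w - b)\<close> in
    \<open>t\<close> is cancelled separately.\<close>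
  define C where "C = 2 * (fact (m + 2) / (1 - \<rho>) ^ (m + 3)) * fact m / bergman_norm V"
  have est: "bergman_norm (\<lambda>z. approach_phase a n w * ext_basis_vec a n w z - R z) \<le> C * cmod (w - b)"
    if w: "w \<in> ball 0 \<rho>" "w \<noteq> b" for w
  proof -
    define s where "s = approach_phase a n w"
    define t where "t = cmod (w - b) ^ m / fact m"
    define u where "u = (\<lambda>z. s * residual n (kernel_at w) z)"
    have wD: "w \<in> unit_disc" using w \<rho> by auto
    have s: "s = sgn (w - b) ^ m" by (simp add: s_def approach_phase_def b_def m_def)
    have ns: "cmod s = 1" using w by (simp add: s norm_power norm_sgn)
    have t: "t > 0" using w by (simp add: t_def)
    have us: "u \<in> bergman_space"
      unfolding u_def by (intro bergman_space_scale residual_in_space bergman_kernel_in_space wD)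
    have nu: "bergman_norm u = bergman_norm (residual n (kernel_at w))"
      by (simp add: u_def bergman_norm_scale ns)
    have nt: "bergman_norm (\<lambda>z. of_real t * V z) = t * bergman_norm V"
      using t by (simp add: bergman_norm_scale)
    have "sgn (w - b) * cnj (w - b) = of_real (cmod (w - b))"
    proof -
      have "sgn (w - b) * cnj (w - b) = of_real ((cmod (w - b))\<^sup>2) / of_real (cmod (w - b))"
        by (simp only: sgn_eq complex_norm_square times_divide_eq_left)
      then show ?thesis using w by (simp add: power2_eq_square)
    qed
    \<comment> \<open>The phase turns the complex Taylor coefficient into the positive number
      \<open>t\<close>.\<close>
    then have st: "s * (cnj (w - b) ^ m / fact m) = of_real t"
      by (simp add: s t_def flip: power_mult_distrib of_real_power)
    have "bergman_norm (\<lambda>z. u z - of_real t * V z)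
        = bergman_norm (\<lambda>z. s * (residual n (kernel_at w) z - cnj (w - b) ^ m / fact m * V z))"
      unfolding st[symmetric] u_def by (simp only: right_diff_distrib mult.assoc)
    also have "\<dots> \<le> fact (m + 2) / (1 - \<rho>) ^ (m + 3) * cmod (w - b) ^ Suc m"
      using residual_kernel_asymptotics[of n \<rho> w] w \<rho> unfolding bergman_norm_scale ns V_def b_def m_def by simp
    finally have diff: "bergman_norm (\<lambda>z. u z - of_real t * V z)
        \<le> fact (m + 2) / (1 - \<rho>) ^ (m + 3) * cmod (w - b) ^ Suc m" .
    \<comment> \<open>Normalizing \<open>t * V\<close> gives the same vector as normalizing
      \<open>V\<close>, so \<open>u\<close> may be compared with the vector it is asymptotic
      to.\<close>
    have "bergman_norm (\<lambda>z. s * ext_basis_vec a n w z - R z)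
        = bergman_norm (\<lambda>z. u z / of_real (bergman_norm u)
            - of_real t * V z / of_real (bergman_norm (\<lambda>z. of_real t * V z)))"
      unfolding nu nt using t by (intro bergman_norm_cong) (simp add: R_eq ext_basis_vec_eq u_def)
    also have "\<dots> \<le> 2 * bergman_norm (\<lambda>z. u z - of_real t * V z) / (t * bergman_norm V)"
      using bergman_normalize_diff[OF us bergman_space_scale[OF Vs, of "of_real t"]] t V_pos
      unfolding nt by simp
    also have "\<dots> \<le> 2 * (fact (m + 2) / (1 - \<rho>) ^ (m + 3) * cmod (w - b) ^ Suc m) / (t * bergman_norm V)"
      using diff t V_pos by (intro divide_right_mono mult_left_mono) auto
    also have "\<dots> = C * cmod (w - b)"
      using w by (simp add: C_def t_def del: fact_Suc)
    finally show ?thesis by (simp add: s_def)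
  qed
  have "((\<lambda>w. C * cmod (w - b)) \<longlongrightarrow> C * cmod (b - b)) (at b)" by (intro tendsto_intros)
  then have "((\<lambda>w. C * cmod (w - b)) \<longlongrightarrow> 0) (at b)" by simp
  then have "((\<lambda>w. bergman_norm (\<lambda>z. approach_phase a n w * ext_basis_vec a n w z - R z)) \<longlongrightarrow> 0) (at b)"
    by (rule Lim_null_comparison[rotated]) (use near est in \<open>auto elim!: eventually_mono\<close>)
  moreover have "\<forall>\<^sub>F w in at b. (\<lambda>z. approach_phase a n w * ext_basis_vec a n w z) \<in> bergman_space"
    using near
  proof eventually_elim
    case (elim w)
    then have "w \<in> unit_disc" using \<rho> by auto
    then show ?case
      unfolding ext_basis_vec_eq
      by (intro bergman_space_scale bergman_space_divide residual_in_space bergman_kernel_in_space)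
  qed
  ultimately show ?thesis using Rs unfolding bergman_tendsto_def R_def b_def by blast
qed

end

text \<open>A reproducing kernel is determined only on the disc; hence existence is asserted
  together with a formula for every \<open>K\<close>. The set \<open>Directions\<close> contains the
  ray \<open>w - a (Suc n) > 0\<close>, so the limit within it is not vacuous.\<close>

theorem theorem3p1:
  fixes a :: "nat \<Rightarrow> complex" and n :: nat
  assumes "\<And>i. i \<ge> 1 \<Longrightarrow> a i \<in> unit_disc"
  shows
    "(\<exists>K. reproducing_kernel (zero_based_subspace (initial_tuple a n)) K) \<and>
     (\<forall>K. reproducing_kernel (zero_based_subspace (initial_tuple a n)) K \<longrightarrow>
        (\<forall>w\<in>unit_disc - set (initial_tuple a n). \<forall>z\<in>unit_disc.
           K z w = of_real (sqrt ((bergman_norm (kernel_at w))\<^sup>2 -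
                       (\<Sum>k=1..n. (cmod (bergman_inner (kernel_at w) (basis_vec a k)))\<^sup>2)))
                   * ext_basis_vec a n w z)) \<and>
     reproducing_kernel (zero_based_subspace (initial_tuple a 0)) bergman_kernel \<and>
     (\<forall>K. reproducing_kernel (zero_based_subspace (initial_tuple a 0)) K \<longrightarrow>
        (\<forall>w\<in>unit_disc. \<forall>z\<in>unit_disc. K z w = bergman_kernel z w)) \<and>
     ((\<exists>k\<in>{1..n}. a (Suc n) = a k) \<longleftrightarrow> occurrence a (Suc n) > 1) \<and>
     ((\<exists>k\<in>{1..n}. a (Suc n) = a k) \<longrightarrow>
        (let R = (\<lambda>z. kernel_residual a n z / of_real (bergman_norm (kernel_residual a n)));
             Directions = {w. approach_phase a n w = 1}
         in
           bergman_tendsto (\<lambda>w z. approach_phase a n w * ext_basis_vec a n w z)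
             R (at (a (Suc n))) \<and>
           bergman_tendsto (ext_basis_vec a n) R (at (a (Suc n)) within Directions) \<and>
           (\<forall>z\<in>unit_disc.
              ((\<lambda>w. approach_phase a n w * ext_basis_vec a n w z) \<longlongrightarrow> R z)
                 (at (a (Suc n))) \<and>
              ((\<lambda>w. ext_basis_vec a n w z) \<longlongrightarrow> R z) (at (a (Suc n)) within Directions) \<and>
              R z = kernel_residual a n z /
                of_real (sqrt ((bergman_norm (gen_kernel a (Suc n)))\<^sup>2 -
                  (\<Sum>k=1..n. (cmod (bergman_inner (gen_kernel a (Suc n))
                                                  (basis_vec a k)))\<^sup>2))) \<and>
              basis_vec a (Suc n) z = R z)))"
proof -
  interpret disc_sequence a by unfold_locales (rule assms)
  let ?Z = "zero_based_subspace (initial_tuple a n)"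
  let ?R = "\<lambda>z. kernel_residual a n z / of_real (bergman_norm (kernel_residual a n))"
  let ?F = "at (a (Suc n)) within {w. approach_phase a n w = 1}"
  have 1: "K z w = of_real (sqrt ((bergman_norm (kernel_at w))\<^sup>2 -
                       (\<Sum>k=1..n. (cmod (bergman_inner (kernel_at w) (basis_vec a k)))\<^sup>2)))
                   * ext_basis_vec a n w z"
    if "reproducing_kernel ?Z K" "w \<in> unit_disc" "z \<in> unit_disc" for K w z
  proof -
    note ks = bergman_kernel_in_space[OF that(2)]
    have "K z w = residual n (kernel_at w) z"
      by (rule reproducing_kernel_unique[OF that(1) reproducing_kernel_residual])
         (use that zero_based_diff in \<open>auto simp: mem_zero_based_iff\<close>)
    \<comment> \<open>If the residual has norm 0, it vanishes on the disc and division by 0 makes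
      \<open>ext_basis_vec\<close> zero, so both sides are 0; otherwise the norm cancels.\<close>
    then show ?thesis
      using bergman_norm_eq_0_imp[OF residual_in_space[OF ks, of n] _ that(3)]
      unfolding norm_residual_eq[OF ks, of n, symmetric] ext_basis_vec_eq by auto
  qed
  have 2: "K z w = bergman_kernel z w"
    if "reproducing_kernel bergman_space K" "w \<in> unit_disc" "z \<in> unit_disc" for K w z
    by (rule reproducing_kernel_unique[OF that(1) reproducing_kernel_bergman])
       (use that in \<open>auto intro: bergman_space_diff\<close>)
  have 3: "(\<exists>k\<in>{1..n}. a (Suc n) = a k) \<longleftrightarrow> occurrence a (Suc n) > 1"
    using count_list_0_iff[of "initial_tuple a n" "a (Suc n)"]
    by (auto simp: occurrence_Suc set_initial_tuple)
  \<comment> \<open>Within this filter the phase is 1, so the unrestricted limit specializes to the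
    vectors themselves.\<close>
  have 4: "bergman_tendsto (ext_basis_vec a n) ?R ?F"
    by (rule bergman_tendsto_restrict[OF ext_basis_vec_tendsto])
       (auto simp: eventually_at_filter at_le)
  have R: "?R z = residual n (gen_kernel a (Suc n)) z / of_real (bergman_norm (residual n (gen_kernel a (Suc n))))"
    if "z \<in> unit_disc" for z
    using that bergman_norm_cong[of "kernel_residual a n" "residual n (gen_kernel a (Suc n))"]
    by (simp add: kernel_residual_eq)
  have 5: "?R z = kernel_residual a n z /
                of_real (sqrt ((bergman_norm (gen_kernel a (Suc n)))\<^sup>2 -
                  (\<Sum>k=1..n. (cmod (bergman_inner (gen_kernel a (Suc n))
                                                  (basis_vec a k)))\<^sup>2)))"
    if "z \<in> unit_disc" for z
    unfolding R[OF that] norm_residual_eq[OF gen_kernel_in_space, of "Suc n" n, symmetric]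
    using that norm_residual_eq[OF gen_kernel_in_space[of "Suc n"], of n] by (simp add: kernel_residual_eq)
  have 6: "basis_vec a (Suc n) z = ?R z" if "z \<in> unit_disc" for z
    unfolding R[OF that] basis_vec_Suc_eq ..
  show ?thesis
    unfolding Let_def initial_tuple_0 zero_based_subspace_Nil
  proof (intro conjI allI impI ballI)
    show "\<exists>K. reproducing_kernel ?Z K"
      using reproducing_kernel_residual by blast
  qed (rule 1 2 3 4 5 6 reproducing_kernel_bergman ext_basis_vec_tendsto bergman_tendsto_pointwise[OF 4]
        bergman_tendsto_pointwise[OF ext_basis_vec_tendsto]; (assumption | erule DiffD1))+
qed

end
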